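(* Let $p\ge 5$ be a prime such that $2p-1$ is also a prime. Then $M(p;2p-1)=3$.
   Context: For $n\ge 1$, $a_n(k)$ denotes the coefficient of $x^k$ in the $n$-th cyclotomic polynomial $\Phi_n(x)$, and $A(n)=\max\{|a_n(k)|:k\ge 0\}$. For primes $2<p<q$, $M(p;q)=\max\{A(pqr): r \text{ prime},\ r>q\}$. *)

theory Defs
  imports
    Complex_Main
    "HOL-Computational_Algebra.Polynomial"
    "HOL-Computational_Algebra.Primes"
begin

definition primitive_unity_root :: "nat \<Rightarrow> complex \<Rightarrow> bool" where
  "primitive_unity_root n z \<longleftrightarrow> z ^ n = 1 \<and> (\<forall>m. 0 < m \<and> m < n \<longrightarrow> z ^ m \<noteq> 1)"

(* Meaningful for n \<ge> 1 only.  The coefficients are rational integers; they are kept inside the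
   complex numbers, so that their absolute value is taken by cmod. *)
definition cyclotomic_poly :: "nat \<Rightarrow> complex poly" where
  "cyclotomic_poly n = (\<Prod>z | primitive_unity_root n z. [:- z, 1:])"

(* Only finitely many coefficients are nonzero, so Max is applied to a finite nonempty set. *)
definition cyclotomic_height :: "nat \<Rightarrow> real" where
  "cyclotomic_height n = Max (range (\<lambda>k. cmod (coeff (cyclotomic_poly n) k)))"

definition ternary_heights :: "nat \<Rightarrow> nat \<Rightarrow> real set" where
  "ternary_heights p q = {cyclotomic_height (p * q * r) | r. prime r \<and> r > q}"

(* The prime r ranges over an infinite set, so Max is meaningful only once ternary_heights p q is
   known to be finite; a claim about the value of max_ternary_height must include this. *)
definition max_ternary_height :: "nat \<Rightarrow> nat \<Rightarrow> real" where
  "max_ternary_height p q = Max (ternary_heights p q)"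

end

theory Submission
  imports Defs
    "HOL-Computational_Algebra.Fundamental_Theorem_Algebra"
    "HOL-Analysis.Analysis"
    "HOL-Number_Theory.Number_Theory"
    "HOL-Computational_Algebra.Squarefree"
    "HOL-Real_Asymp.Real_Asymp"
begin

hide_const (open) up_ring.monom up_ring.coeff

text \<open>
  Write $q = 2p - 1$.  Since $2p = q + 1$, the binary cyclotomic polynomial is very
  simple:
  \[ \Phi_{pq}(t) = (1 + t^p) \sum_{y < p-1} t^{qy} - t \sum_{j < q-2} t^{pj}. \]
  For a prime $r > q$ the quotient $\Phi_{pqr}(x) = \Phi_{pq}(x^r) / \Phi_{pq}(x)$ becomes
  \[ \Phi_{pqr}(x)\,(x^{pq} - 1) = \Phi_{pq}(x^r)\,(1 + x + \dots + x^{p-1})\,(x^q - 1), \]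
  and expanding $1 / (1 - x^{pq})$ shows that the coefficient of $x^n$ is $c(n) - c(n - q)$.  Here
  $c(n)$ counts, with the sign of the coefficient of $t^i$ in $\Phi_{pq}(t)$, the pairs $(i, m)$ with
  $m < p$, $ri + m \le n$ and $ri + m \equiv n \pmod{pq}$ (\<open>coeff_cyclotomic_poly\<close>).

  Upper bound: the exponents $i$ fall into three families, $qy$ and $p + qy$ with sign $+$ and
  $1 + pj$ with sign $-$, and each is constant modulo $q$ or modulo $p$.  The congruence then
  fixes $m$ modulo that prime, hence $m$, hence $i$.  So each family contributes at most one
  pair, $-1 \le c(n) \le 2$, and every coefficient is an integer of absolute value at most $3$
  (\<open>cmod_coeff_ternary\<close>).  In particular only finitely many heights occur.

  Lower bound: the value $3$ needs $c(n) = 2$ and $c(n - q) = -1$.  If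
  $r \equiv 2 \pmod p$ and $r \equiv -4 \pmod q$, and $r$ is large, an explicit $n \equiv 2 \pmod{pq}$
  achieves this (\<open>coeff_eq_3\<close>); the argument uses $p \ge 7$, which holds because $2 \cdot 5 - 1 = 9$ is
  not prime.

  That such a prime $r$ exists is an instance of Dirichlet's theorem on primes in arithmetic
  progressions, which is proved for squarefree moduli (\<open>dirichlet_squarefree\<close>).  For a
  character $\xi$ the series $H = \sum \xi(n) \Lambda(n) n^{-s}$ satisfies $L \cdot H = \sum \xi(n) \log(n)\, n^{-s}$ for $s > 1$, and for
  a nonprincipal character the right side stays bounded as $s \to 1$.  If $L(1, \xi) \neq 0$ for all
  of these, their $H$ stay bounded too.  If there were only finitely many primes in the progression,
  orthogonality would make $H$ bounded for the principal character as well, and integrating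
  $L'/L = -H$ would bound $\sum n^{-s}$ over $n$ coprime to the modulus, which is absurd.

  The nonvanishing $L(1, \xi) \neq 0$ has two parts.  The product of all $L(s, \xi)$ has logarithmic derivative $\le 0$, so
  it cannot tend to $0$ as $s$ decreases to $1$; as the principal factor has only a simple pole, at most one factor vanishes
  at $1$ (\<open>L_series_at_most_one_zero\<close>), and zeros of nonreal characters would come in conjugate pairs.
  For a real character Monsky's argument with the Lambert series $\sum \xi(n) x^n / (1 - x^n)$ applies
  (\<open>L_series_real_nonzero\<close>).
\<close>

section \<open>The cyclotomic polynomial of a product of three primes\<close>

text \<open>
  The derivative of $x^n - 1$ has no root other than $0$, so $x^n - 1$ is squarefree and thus
  the product of its distinct linear factors.
\<close>
lemma prod_unity_roots:
  assumes "n > 0"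
  shows "(\<Prod>z | z ^ n = (1::complex). [:- z, 1:]) = monom 1 n - 1"
proof -
  let ?P = "monom 1 n - 1 :: complex poly"
  have deg: "degree ?P = n"
    using assms degree_add_eq_left[of "-1" "monom (1::complex) n"] by (simp add: degree_monom_eq)
  have lc: "lead_coeff ?P = 1"
    using assms by (simp add: deg)
  have "rsquarefree ?P"
  proof (unfold rsquarefree_roots, intro allI notI, elim conjE)
    fix z assume z: "poly ?P z = 0" "poly (pderiv ?P) z = 0"
    from z(2) have "z = 0" using assms by (auto simp: pderiv_diff pderiv_monom poly_monom)
    with z(1) assms show False by (simp add: poly_monom zero_power)
  qed
  moreover have "{z. poly ?P z = 0} = {z. z ^ n = 1}"
    by (simp add: poly_monom)
  ultimately show ?thesis
    using complex_poly_decompose_rsquarefree[of ?P] unfolding lc by simp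
qed

lemma power_eq_1_gcd:
  fixes z :: complex
  assumes "z ^ a = 1" "z ^ b = 1"
  shows "z ^ gcd a b = 1"
proof (cases "a = 0")
  case False
  then obtain x y where "a * x = b * y + gcd a b" using bezout_nat by blast
  then have "(z ^ a) ^ x = (z ^ b) ^ y * z ^ gcd a b"
    by (simp flip: power_mult power_add)
  with assms show ?thesis by simp
qed (use assms in simp)

lemma unity_roots_Int:
  "{z::complex. z ^ a = 1} \<inter> {z. z ^ b = 1} = {z. z ^ gcd a b = 1}"
proof -
  have "z ^ a = 1 \<and> z ^ b = 1" if "z ^ gcd a b = 1" for z :: complex
    by (metis that dvdE gcd_dvd1 gcd_dvd2 power_mult power_one)
  then show ?thesis by (auto intro: power_eq_1_gcd)
qed

text \<open>
  A root of unity of order properly dividing $pqr$ has an order that omits one of the three primes.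
\<close>
lemma primitive_unity_roots_ternary:
  assumes "prime p" "prime q" "prime r" "p \<noteq> q" "p \<noteq> r" "q \<noteq> r"
  shows "{z. primitive_unity_root (p * q * r) z} =
    {z. z ^ (p * q * r) = 1} - ({z. z ^ (p * q) = 1} \<union> {z. z ^ (p * r) = 1} \<union> {z. z ^ (q * r) = 1})"
proof -
  let ?n = "p * q * r"
  have pos: "p > 1" "q > 1" "r > 1" using assms prime_gt_1_nat by auto
  have "z ^ (p * q) = 1 \<or> z ^ (p * r) = 1 \<or> z ^ (q * r) = 1"
    if z: "z ^ ?n = 1" and m: "0 < m" "m < ?n" "z ^ m = 1" for z :: complex and m
  proof -
    obtain g where g: "g = gcd m ?n" by blast
    have zg: "z ^ g = 1" using power_eq_1_gcd z m g by blast
    have "g < ?n" using m g gcd_le1_nat[of m ?n] by linarith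
    have "g dvd ?n" unfolding g by (rule gcd_dvd2)
    then obtain d where d: "?n = g * d" by (rule dvdE)
    with \<open>g < ?n\<close> have "d \<noteq> 1" by auto
    then obtain l where l: "prime l" "l dvd d" using prime_factor_nat by blast
    then obtain e where e: "d = l * e" by blast
    have "l dvd ?n" unfolding d using l by simp
    then have lc: "l = p \<or> l = q \<or> l = r"
      using l assms by (metis prime_dvd_mult_iff primes_dvd_imp_eq)
    have eq: "p * q * r = l * (g * e)" using d e by (simp only: mult_ac)
    have one: "z ^ (g * e) = 1" using zg by (simp add: power_mult)
    have "q * r = g * e \<or> p * r = g * e \<or> p * q = g * e"
    proof -
      have "l * (q * r) = l * (g * e) \<or> l * (p * r) = l * (g * e) \<or> l * (p * q) = l * (g * e)"
        using lc eq[symmetric] by (auto simp only: mult_ac)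
      then show ?thesis using l(1) by (auto simp: prime_gt_0_nat)
    qed
    then show ?thesis using one by metis
  qed
  moreover have "\<exists>m. 0 < m \<and> m < ?n \<and> z ^ m = 1"
    if "z ^ (p * q) = 1 \<or> z ^ (p * r) = 1 \<or> z ^ (q * r) = 1" for z :: complex
  proof -
    have "0 < p * q" "p * q < ?n" "0 < p * r" "p * r < ?n" "0 < q * r" "q * r < ?n"
      using pos by auto
    with that show ?thesis by blast
  qed
  ultimately show ?thesis unfolding primitive_unity_root_def by blast
qed

text \<open>
  Inclusion and exclusion over the three sets of roots of unity removed from the
  $pqr$-th ones; the cofactors are kept on the left to avoid dividing polynomials.
\<close>
lemma cyclotomic_poly_ternary:
  assumes "prime p" "prime q" "prime r" "p \<noteq> q" "p \<noteq> r" "q \<noteq> r"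
  defines "X \<equiv> \<lambda>n. monom 1 n - 1 :: complex poly"
  shows "cyclotomic_poly (p * q * r) * X (p * q) * X (p * r) * X (q * r) * X 1 =
    X (p * q * r) * X p * X q * X r"
proof -
  define U where "U n = {z::complex. z ^ n = 1}" for n
  define F where "F A = (\<Prod>z\<in>A. [:- z, 1:])" for A :: "complex set"
  have pos: "p > 0" "q > 0" "r > 0" using assms prime_gt_0_nat by auto
  have FU: "F (U n) = X n" if "n > 0" for n
    using prod_unity_roots[OF that] by (simp add: F_def U_def X_def)
  have fin: "finite (U n)" if "n > 0" for n
    unfolding U_def using that by (intro finite_roots_unity) auto
  have FF: "F (A \<union> B) * F (A \<inter> B) = F A * F B" if "finite A" "finite B" for A B
    unfolding F_def using that by (rule prod.union_inter)
  have cop: "coprime p q" "coprime p r" "coprime q r"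
    using assms by (auto intro: primes_coprime)
  have g: "gcd (p*q) (p*r) = p" "gcd (p*q) (q*r) = q" "gcd (p*r) (q*r) = r" "gcd q r = 1"
    using cop gcd_mult_distrib_nat[of p q r] gcd_mult_distrib_nat[of q p r]
      gcd_mult_distrib_nat[of r p q]
    by (simp_all add: ac_simps)
  have I: "U a \<inter> U b = U (gcd a b)" for a b
    unfolding U_def by (rule unity_roots_Int)
  let ?A = "U (p*q) \<union> U (p*r)" let ?B = "?A \<union> U (q*r)"
  have fins: "finite (U p)" "finite (U q)" "finite (U r)" "finite (U (p*q))" "finite (U (p*r))"
    "finite (U (q*r))" "finite (U (p*q*r))" using pos by (auto intro: fin)
  have 1: "F ?A * X p = X (p*q) * X (p*r)"
    using FF[of "U (p*q)" "U (p*r)"] fins pos by (simp add: I g FU)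
  have "?A \<inter> U (q*r) = U q \<union> U r"
    by (simp add: Int_Un_distrib2 I g)
  then have 2: "F ?B * F (U q \<union> U r) = F ?A * X (q*r)"
    using FF[of ?A "U (q*r)"] fins pos by (simp add: FU)
  have 3: "F (U q \<union> U r) * X 1 = X q * X r"
    using FF[of "U q" "U r"] fins pos FU[of 1] by (simp add: FU I g)
  have sub: "?B \<subseteq> U (p*q*r)"
  proof -
    have "z ^ (a * b) = 1" if "z ^ a = 1" for z :: complex and a b
      using that by (simp add: power_mult)
    from this[of _ "p * q" r] this[of _ "p * r" q] this[of _ "q * r" p] show ?thesis
      by (auto simp: U_def ac_simps)
  qed
  have 4: "cyclotomic_poly (p*q*r) * F ?B = X (p*q*r)"
  proof -
    have "cyclotomic_poly (p*q*r) = F (U (p*q*r) - ?B)"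
      unfolding cyclotomic_poly_def F_def U_def
      using primitive_unity_roots_ternary[OF assms(1-6)] by simp
    then show ?thesis
      using prod.subset_diff[OF sub, of "\<lambda>z. [:- z, 1:]"] fins(7) FU[of "p*q*r"] pos
      by (simp add: F_def)
  qed
  have "cyclotomic_poly (p * q * r) * (X (p * q) * X (p * r)) * X (q * r) * X 1
      = cyclotomic_poly (p * q * r) * (F ?A * X p) * X (q*r) * X 1" by (simp only: 1)
  also have "\<dots> = cyclotomic_poly (p * q * r) * (F ?A * X (q*r)) * X p * X 1" by (simp only: mult_ac)
  also have "\<dots> = (cyclotomic_poly (p * q * r) * F ?B) * (F (U q \<union> U r) * X 1) * X p"
    unfolding 2[symmetric] by (simp only: mult_ac)
  also have "\<dots> = X (p * q * r) * X p * X q * X r" unfolding 3 4 by (simp only: mult_ac)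
  finally show ?thesis by (simp only: mult_ac)
qed

section \<open>Coefficients as signed counts of solutions of a congruence\<close>

lemma monom_1_mult: "(monom 1 (a * b) :: 'a::comm_semiring_1 poly) = monom 1 a ^ b"
  by (simp add: monom_power)

lemma geometric_sum_mult:
  fixes t :: "'a::comm_ring_1"
  shows "(\<Sum>i<n. t ^ i) * (t - 1) = t ^ n - 1"
  by (metis power_diff_1_eq mult.commute)

text \<open>
  For $q = 2p - 1$ this is the explicit form of $\Phi_{pq}(t)$.  The argument ranges over an arbitrary ring because
  it is used with $t = x^r$.
\<close>
definition binary_poly :: "nat \<Rightarrow> nat \<Rightarrow> 'a::comm_ring_1 \<Rightarrow> 'a" where
  "binary_poly p q t = (1 + t ^ p) * (\<Sum>y<p-1. (t ^ q) ^ y) - t * (\<Sum>j<q-2. (t ^ p) ^ j)"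

text \<open>
  The defining relation of $\Phi_{pq}$.  Both geometric sums telescope, and what remains is an
  identity between monomials that follows from $2p = q + 1$; in terms of $k = p - 1$, $w = t^k$
  and $c = t^{2k^2 + k - 1}$ it is a polynomial identity.
\<close>
lemma binary_poly_mult:
  fixes t :: "'a::comm_ring_1"
  assumes "p \<ge> 2" "q = 2 * p - 1"
  shows "binary_poly p q t * (t ^ p - 1) * (t ^ q - 1) = (t ^ (p * q) - 1) * (t - 1)"
proof -
  obtain k where k: "p = k + 1" "k \<ge> 1" "q = 2 * k + 1" using assms by (intro that[of "p - 1"]) auto
  obtain l where l: "k = Suc l" using k by (cases k) auto
  define w where "w = t ^ k"
  define c where "c = t ^ (2 * k * k + k - 1)"
  have tp: "t ^ p = w * t" and tq: "t ^ q = w * w * t"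
    unfolding k w_def mult_2 power_add power_one_right by (rule refl)+
  have e1: "q * (p - 1) = Suc (2 * k * k + k - 1)" "p * (q - 2) = 2 * k * k + k - 1"
    "p * q = (2 * k * k + k - 1) + k + k + 2"
    using k l by (simp_all add: algebra_simps)
  have t1: "(t ^ q) ^ (p - 1) = c * t"
    by (simp only: power_mult[symmetric] e1 c_def power_Suc mult_ac)
  have t2: "(t ^ p) ^ (q - 2) = c"
    by (simp only: power_mult[symmetric] e1 c_def)
  have t3: "t ^ (p * q) = c * w * w * t * t"
    unfolding e1 by (simp add: power_add w_def c_def power2_eq_square mult_ac)
  have g1: "(\<Sum>y<p-1. (t ^ q) ^ y) * (t ^ q - 1) = c * t - 1"
    unfolding geometric_sum_mult t1 ..
  have g2: "(\<Sum>j<q-2. (t ^ p) ^ j) * (t ^ p - 1) = c - 1"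
    unfolding geometric_sum_mult t2 ..
  have split: "(a * u - t * v) * x * y = a * x * (u * y) - t * (v * x) * y" for a u v x y :: 'a
    by (simp add: algebra_simps)
  have "binary_poly p q t * (t ^ p - 1) * (t ^ q - 1) =
      (1 + t ^ p) * (t ^ p - 1) * ((\<Sum>y<p-1. (t ^ q) ^ y) * (t ^ q - 1)) -
      t * ((\<Sum>j<q-2. (t ^ p) ^ j) * (t ^ p - 1)) * (t ^ q - 1)"
    unfolding binary_poly_def by (rule split)
  also have "\<dots> = (1 + w * t) * (w * t - 1) * (c * t - 1) - t * (c - 1) * (w * w * t - 1)"
    unfolding g1 g2 unfolding tp tq ..
  also have "\<dots> = (c * w * w * t * t - 1) * (t - 1)"
    by (simp add: algebra_simps)
  finally show ?thesis unfolding t3 .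
qed

lemma cyclotomic_poly_binary_factor:
  fixes p :: nat
  assumes "prime p" "prime q" "prime r" "p \<noteq> r" "q \<noteq> r" "q = 2 * p - 1"
  defines "X \<equiv> \<lambda>n. monom 1 n - 1 :: complex poly"
  shows "cyclotomic_poly (p * q * r) * X (p * q) =
    binary_poly p q (monom 1 r) * (\<Sum>m<p. monom 1 m) * X q"
proof -
  have p2: "p \<ge> 2" using assms(1) prime_ge_2_nat by blast
  then have "p \<noteq> q" using assms by auto
  have pos: "p > 0" "q > 0" "r > 0" using assms(1-3) prime_gt_0_nat by blast+
  define Q where "Q = binary_poly p q (monom 1 r :: complex poly)"
  define G where "G = (\<Sum>m<p. monom 1 m :: complex poly)"
  let ?F = "cyclotomic_poly (p * q * r)"
  have Xn: "X n \<noteq> 0" if "n > 0" for n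
  proof
    assume "X n = 0"
    then have "coeff (X n) n = 0" by simp
    with that show False by (simp add: X_def)
  qed
  have Q: "Q * X (p * r) * X (q * r) = X (p * q * r) * X r"
    using binary_poly_mult[OF p2 assms(6), of "monom 1 r :: complex poly"]
    unfolding Q_def X_def by (simp only: monom_1_mult[symmetric] mult_ac)
  have G: "G * X 1 = X p"
    using geometric_sum_mult[of "monom 1 1 :: complex poly" p]
    by (simp add: G_def X_def monom_power)
  have "(?F * X (p * q)) * (X (p * r) * X (q * r) * X 1) = X (p * q * r) * X r * X p * X q"
    using cyclotomic_poly_ternary[OF assms(1-3) \<open>p \<noteq> q\<close> assms(4,5)]
    unfolding X_def by (simp only: mult_ac)
  also have "\<dots> = (Q * X (p * r) * X (q * r)) * (G * X 1) * X q" by (simp only: Q G)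
  also have "\<dots> = (Q * G * X q) * (X (p * r) * X (q * r) * X 1)" by (simp only: mult_ac)
  finally have "?F * X (p * q) = Q * G * X q"
    using Xn pos by simp
  then show ?thesis by (simp only: Q_def G_def)
qed

text \<open>
  For $M > 0$ this is the coefficient of $x^n$ in the power series $V / (1 - x^M)$.
\<close>
definition residue_sum :: "nat \<Rightarrow> 'a::comm_ring_1 poly \<Rightarrow> nat \<Rightarrow> 'a" where
  "residue_sum M V n = (\<Sum>i | i \<le> n \<and> [i = n] (mod M). coeff V i)"

lemma residue_sum_add: "residue_sum M (V + W) n = residue_sum M V n + residue_sum M W n"
  and residue_sum_diff: "residue_sum M (V - W) n = residue_sum M V n - residue_sum M W n"
  by (simp_all add: residue_sum_def sum.distrib sum_subtractf)

lemma residue_sum_sum: "residue_sum M (sum f A) n = (\<Sum>a\<in>A. residue_sum M (f a) n)"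
  by (simp add: residue_sum_def coeff_sum sum.swap[of _ A])

lemma residue_sum_monom: "residue_sum M (monom 1 e) n = of_bool (e \<le> n \<and> [e = n] (mod M))"
  by (auto simp: residue_sum_def coeff_monom if_distrib sum.If_cases Int_def cong: if_cong)

lemma residue_sum_shift:
  "residue_sum M (monom 1 e * V) n = (if e \<le> n then residue_sum M V (n - e) else 0)"
proof (cases "e \<le> n")
  case True
  let ?S = "{i. i \<le> n \<and> [i = n] (mod M)}" let ?T = "{i. i \<le> n - e \<and> [i = n - e] (mod M)}"
  have "residue_sum M (monom 1 e * V) n = (\<Sum>i\<in>?S. if e \<le> i then coeff V (i - e) else 0)"
    unfolding residue_sum_def by (intro sum.cong) (auto simp: coeff_monom_mult)
  also have "\<dots> = (\<Sum>i | i \<in> ?S \<and> e \<le> i. coeff V (i - e))"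
    by (rule sum.inter_filter[symmetric]) (rule finite_subset[of _ "{..n}"], auto)
  also have "\<dots> = (\<Sum>i\<in>?T. coeff V i)"
  proof (rule sum.reindex_bij_witness[of _ "\<lambda>i. i + e" "\<lambda>i. i - e"])
    fix i assume "i \<in> {i. i \<in> ?S \<and> e \<le> i}"
    then have "i \<le> n" "[(i - e) + e = (n - e) + e] (mod M)" "e \<le> i" using True by auto
    then show "i - e \<in> ?T" by (simp only: cong_add_rcancel_nat) auto
  next
    fix i assume "i \<in> ?T"
    then have "i \<le> n - e" "[i + e = (n - e) + e] (mod M)" by (auto simp only: cong_add_rcancel_nat)
    with True show "i + e \<in> {i. i \<in> ?S \<and> e \<le> i}" by auto
  qed auto
  finally show ?thesis using True by (simp add: residue_sum_def)
next
  case False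
  then show ?thesis by (auto simp: residue_sum_def coeff_monom_mult intro!: sum.neutral)
qed

text \<open>
  Multiplication by $1 - x^M$ undoes the division by $1 - x^M$ that is implicit in
  \<open>residue_sum\<close>.
\<close>
lemma residue_sum_telescope:
  assumes "M > 0"
  shows "residue_sum M (V * (monom 1 M - 1)) n = - coeff V n"
proof -
  have S: "{i. i \<le> n \<and> [i = n] (mod M)} = 
     (if M \<le> n then insert n {i. i \<le> n - M \<and> [i = n - M] (mod M)} else {n})"
    (is "?L = ?R")
  proof (intro subset_antisym subsetI)
    fix i assume "i \<in> ?L"
    then have i: "i \<le> n" "[n = i] (mod M)" by (auto simp: cong_sym_eq)
    then obtain k where "n = i + k * M"
      by (metis cong_le_nat cong_sym_eq add.commute mult.commute)
    with assms show "i \<in> ?R" by (cases k) (auto simp: cong_def)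
  next
    fix i assume i: "i \<in> ?R"
    show "i \<in> ?L"
    proof (cases "i = n")
      case False
      with i have i: "M \<le> n" "i \<le> n - M" "[i = n - M] (mod M)" by (auto split: if_splits)
      have "[n - M = n] (mod M)" using i(1) by (simp add: cong_def le_mod_geq)
      with i show ?thesis by (auto intro: cong_trans)
    qed auto
  qed
  have "residue_sum M V n = coeff V n + (if M \<le> n then residue_sum M V (n - M) else 0)"
  proof (cases "M \<le> n")
    case True
    then show ?thesis using assms
      unfolding residue_sum_def S by (subst if_P, simp, subst sum.insert) 
        (auto intro: finite_subset[of _ "{..n}"])
  qed (simp add: residue_sum_def S)
  then show ?thesis
    by (simp add: ring_distribs residue_sum_diff mult.commute[of V] residue_sum_shift)
qed

text \<open>
  Each pair marks one way in which $x^n$ arises from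
  $\left(\sum_{i \in S} x^{ri}\right) (1 + \dots + x^{p-1}) / (1 - x^M)$.
\<close>
definition hits :: "nat \<Rightarrow> nat \<Rightarrow> nat \<Rightarrow> nat set \<Rightarrow> nat \<Rightarrow> (nat \<times> nat) set" where
  "hits p M r S n = {(i, m). i \<in> S \<and> m < p \<and> r * i + m \<le> n \<and> [r * i + m = n] (mod M)}"

lemma finite_hits: "finite S \<Longrightarrow> finite (hits p M r S n)"
  by (rule finite_subset[of _ "S \<times> {..<p}"]) (auto simp: hits_def)

lemma residue_sum_hits:
  assumes "finite S"
  shows "residue_sum M ((\<Sum>i\<in>S. monom 1 r ^ i) * (\<Sum>m<p. monom 1 m)) n =
    of_nat (card (hits p M r S n))"
proof -
  have "residue_sum M ((\<Sum>i\<in>S. monom 1 r ^ i) * (\<Sum>m<p. monom 1 m)) n =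
     (\<Sum>i\<in>S. \<Sum>m<p. of_bool (r * i + m \<le> n \<and> [r * i + m = n] (mod M)))"
    by (simp add: sum_product residue_sum_sum residue_sum_monom monom_power mult_monom)
  also have "\<dots> = (\<Sum>x\<in>S \<times> {..<p}. of_bool (x \<in> hits p M r S n))"
    by (subst sum.cartesian_product) (auto intro!: sum.cong simp: hits_def)
  also have "\<dots> = of_nat (card ((S \<times> {..<p}) \<inter> {x. x \<in> hits p M r S n}))"
    using assms by (subst sum_of_bool_eq) auto
  also have "(S \<times> {..<p}) \<inter> {x. x \<in> hits p M r S n} = hits p M r S n"
    by (auto simp: hits_def)
  finally show ?thesis .
qed

text \<open>
  If $S$ is constant modulo a divisor $l \ge p$ of $M$, the congruence determines $m$ modulo $l$, hence $m$,
  and then $i$ modulo $M$ because $r$ is invertible.  This is the source of the bound $3$.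
\<close>
lemma card_hits_le_1:
  assumes "finite S" "S \<subseteq> {..<M}" "coprime r M" "l dvd M" "p \<le> l" "\<And>i. i \<in> S \<Longrightarrow> [i = s] (mod l)"
  shows "card (hits p M r S n) \<le> 1"
proof -
  have "x = y" if "x \<in> hits p M r S n" "y \<in> hits p M r S n" for x y
  proof -
    obtain i m i' m' where xy: "x = (i, m)" "y = (i', m')" by fastforce
    from that have 1: "i \<in> S" "m < p" "i' \<in> S" "m' < p"
       and c: "[r * i + m = r * i' + m'] (mod M)"
      by (auto simp: xy hits_def cong_def)
    from 1 assms(6) have "[i = i'] (mod l)" by (meson cong_sym cong_trans)
    then have "[r * i = r * i'] (mod l)" by (rule cong_scalar_left)
    moreover have "[r * i + m = r * i' + m'] (mod l)" using c assms(4) by (rule cong_dvd_modulus_nat)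
    ultimately have "[m = m'] (mod l)"
      by (metis cong_add_lcancel_nat cong_add cong_refl cong_sym cong_trans)
    then have "m = m'" using 1 assms(5) by (intro cong_less_imp_eq_nat) auto
    with c have "[r * i = r * i'] (mod M)" by (simp add: cong_add_rcancel_nat)
    then have "[i = i'] (mod M)" using assms(3) by (simp add: cong_mult_lcancel_nat)
    then have "i = i'" using 1 assms(2) by (intro cong_less_imp_eq_nat) auto
    with \<open>m = m'\<close> xy show ?thesis by simp
  qed
  then have "\<forall>x\<in>hits p M r S n. \<forall>y\<in>hits p M r S n. x = y" by blast
  then show ?thesis
    by (simp add: card_le_Suc0_iff_eq finite_hits assms(1))
qed

text \<open>
  The exponents in $\Phi_{pq}$ with coefficient $1$ are those in \<open>pos_support\<close> and
  \<open>shifted_pos_support\<close>, those with coefficient $-1$ the ones in \<open>neg_support\<close>.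
\<close>
definition pos_support :: "nat \<Rightarrow> nat \<Rightarrow> nat set" where "pos_support p q = (\<lambda>y. q * y) ` {..<p-1}"
definition shifted_pos_support :: "nat \<Rightarrow> nat \<Rightarrow> nat set" where "shifted_pos_support p q = (\<lambda>y. p + q * y) ` {..<p-1}"
definition neg_support :: "nat \<Rightarrow> nat \<Rightarrow> nat set" where "neg_support p q = (\<lambda>j. 1 + p * j) ` {..<q-2}"

lemma binary_poly_support:
  assumes "p > 0" "q > 0"
  shows "binary_poly p q t = (\<Sum>i\<in>pos_support p q. t ^ i) + (\<Sum>i\<in>shifted_pos_support p q. t ^ i) - (\<Sum>i\<in>neg_support p q. t ^ i)"
  using assms unfolding binary_poly_def pos_support_def shifted_pos_support_def neg_support_def
  by (simp add: sum.reindex inj_on_def power_add power_mult ring_distribs sum_distrib_left sum.distrib)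

text \<open>
  The signed count $c(n)$ of the introduction.
\<close>
definition hit_count :: "nat \<Rightarrow> nat \<Rightarrow> nat \<Rightarrow> nat \<Rightarrow> int" where
  "hit_count p q r n = int (card (hits p (p * q) r (pos_support p q) n)) + int (card (hits p (p * q) r (shifted_pos_support p q) n))
     - int (card (hits p (p * q) r (neg_support p q) n))"

lemma coeff_cyclotomic_poly:
  fixes p :: nat
  assumes "prime p" "prime q" "prime r" "p \<noteq> r" "q \<noteq> r" "q = 2 * p - 1"
  shows "coeff (cyclotomic_poly (p * q * r)) n =
    of_int (hit_count p q r n - (if q \<le> n then hit_count p q r (n - q) else 0))"
proof -
  have pos: "p > 0" "q > 0" using assms(1,2) prime_gt_0_nat by blast+
  define V where "V = binary_poly p q (monom 1 r) * (\<Sum>m<p. monom 1 m :: complex poly)"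
  have V: "residue_sum (p * q) V n = of_int (hit_count p q r n)" for n
    unfolding V_def binary_poly_support[OF pos] hit_count_def
    by (simp add: ring_distribs residue_sum_add residue_sum_diff residue_sum_hits pos_support_def shifted_pos_support_def neg_support_def)
  have "- coeff (cyclotomic_poly (p * q * r)) n = residue_sum (p * q) (V * (monom 1 q - 1)) n"
    using residue_sum_telescope[of "p * q" "cyclotomic_poly (p * q * r)" n] pos
      cyclotomic_poly_binary_factor[OF assms] by (simp add: V_def)
  also have "\<dots> = (if q \<le> n then residue_sum (p * q) V (n - q) else 0) - residue_sum (p * q) V n"
    by (simp add: ring_distribs residue_sum_diff mult.commute[of V] residue_sum_shift)
  finally have "coeff (cyclotomic_poly (p * q * r)) n =
     residue_sum (p * q) V n - (if q \<le> n then residue_sum (p * q) V (n - q) else 0)"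
    by (simp add: algebra_simps minus_equation_iff)
  then show ?thesis by (simp add: V)
qed

section \<open>Heights are at most 3, and 3 is attained\<close>

lemma card_hits_support_le_1:
  assumes "prime p" "prime q" "prime r" "p \<noteq> r" "q \<noteq> r" "q = 2 * p - 1"
  shows "card (hits p (p * q) r (pos_support p q) n) \<le> 1"
    and "card (hits p (p * q) r (shifted_pos_support p q) n) \<le> 1"
    and "card (hits p (p * q) r (neg_support p q) n) \<le> 1"
proof -
  have p2: "p \<ge> 2" using assms(1) prime_ge_2_nat by blast
  have cop: "coprime r (p * q)"
    using assms by (simp add: primes_coprime)
  have "q * y < p * q" if "y < p - 1" for y
    using that p2 assms(6) by (simp add: mult.commute[of p])
  then show "card (hits p (p * q) r (pos_support p q) n) \<le> 1"
    using p2 assms(6)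
    by (intro card_hits_le_1[where l = q and s = 0] cop) (auto simp: pos_support_def cong_def)
  have "p + q * y < p * q" if "y < p - 1" for y
  proof -
    have "q * (y + 2) \<le> q * p" using that by (intro mult_le_mono2) auto
    moreover have "p < q * 2" using p2 assms(6) by simp
    ultimately show ?thesis by (simp add: algebra_simps)
  qed
  then show "card (hits p (p * q) r (shifted_pos_support p q) n) \<le> 1"
    using p2 assms(6)
    by (intro card_hits_le_1[where l = q and s = p] cop) (auto simp: shifted_pos_support_def cong_def)
  have "1 + p * j < p * q" if "j < q - 2" for j
  proof -
    have "p * (j + 1) < p * q" using that p2 by (intro mult_strict_left_mono) auto
    then show ?thesis using p2 by (simp add: algebra_simps)
  qed
  then show "card (hits p (p * q) r (neg_support p q) n) \<le> 1"
    by (intro card_hits_le_1[where l = p and s = 1] cop)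
      (auto simp: neg_support_def cong_def simp del: One_nat_def plus_1_eq_Suc)
qed

text \<open>
  Both $c(n)$ and $c(n - q)$ lie between $-1$ and $2$.
\<close>
lemma cmod_coeff_ternary:
  assumes "prime p" "prime q" "prime r" "p \<noteq> r" "q \<noteq> r" "q = 2 * p - 1"
  shows "cmod (coeff (cyclotomic_poly (p * q * r)) n) \<in> {0, 1, 2, 3}"
proof -
  define k where "k = hit_count p q r n - (if q \<le> n then hit_count p q r (n - q) else 0)"
  have b: "-1 \<le> hit_count p q r i \<and> hit_count p q r i \<le> 2" for i
    using card_hits_support_le_1[OF assms, of i] unfolding hit_count_def by linarith
  have "\<bar>k\<bar> \<le> 3" using b[of n] b[of "n - q"] unfolding k_def by (auto split: if_splits)
  then have "\<bar>k\<bar> \<in> {0, 1, 2, 3}" by auto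
  moreover have "cmod (coeff (cyclotomic_poly (p * q * r)) n) = of_int \<bar>k\<bar>"
    unfolding coeff_cyclotomic_poly[OF assms] k_def[symmetric] by simp
  ultimately show ?thesis by auto
qed

lemma cyclotomic_height_ternary:
  assumes "prime p" "prime q" "prime r" "p \<noteq> r" "q \<noteq> r" "q = 2 * p - 1"
  shows "cyclotomic_height (p * q * r) \<in> {0, 1, 2, 3}"
    and "cmod (coeff (cyclotomic_poly (p * q * r)) n) \<le> cyclotomic_height (p * q * r)"
proof -
  let ?H = "range (\<lambda>k. cmod (coeff (cyclotomic_poly (p * q * r)) k))"
  have sub: "?H \<subseteq> {0, 1, 2, 3}" using cmod_coeff_ternary[OF assms] by blast
  then have fin: "finite ?H" by (rule finite_subset) simp
  show "cyclotomic_height (p * q * r) \<in> {0, 1, 2, 3}"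
    unfolding cyclotomic_height_def using Max_in[OF fin] sub by blast
  show "cmod (coeff (cyclotomic_poly (p * q * r)) n) \<le> cyclotomic_height (p * q * r)"
    unfolding cyclotomic_height_def using fin by (intro Max_ge) auto
qed

lemma hitsI:
  assumes "i \<in> S" "m < p" "r * i + m \<le> n" "int M dvd int r * int i + int m - int n"
  shows "(i, m) \<in> hits p M r S n"
  using assms by (simp add: hits_def cong_int_iff[symmetric] cong_iff_dvd_diff)

lemma hitsD:
  assumes "(i, m) \<in> hits p M r S n"
  shows "i \<in> S" "m < p" "r * i + m \<le> n" "int M dvd int r * int i + int m - int n"
  using assms by (simp_all add: hits_def cong_int_iff[symmetric] cong_iff_dvd_diff)

lemma zdvd_range_eq:
  fixes a b m :: int
  assumes "m dvd a - b" "\<bar>a - b\<bar> < m"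
  shows "a = b"
proof (rule ccontr)
  assume "a \<noteq> b"
  then show False using assms zdvd_not_zless[of "\<bar>a - b\<bar>" m] by simp
qed

text \<open>
  With $r \equiv 2 \pmod p$ and $r \equiv -4 \pmod q$, where $2p \equiv 1 \pmod q$ and
  $q \equiv -1 \pmod p$, the congruences for $n$ and for $n - q$ can be solved explicitly in each
  family of exponents.  For $n$ the two positive families have the solutions $(0, 2)$ and
  $(p + q, 4)$, with small first component, whereas the only candidate in the negative family
  is $1 + p(q - 3)$.  For $n - q$ the candidates in the positive families are at least $q(p - 1)/2$,
  whereas the negative family has the solution $(1 + p(p - 3), 1)$.  The size of $n$ is chosen so
  that precisely the exponents up to $1 + p(p - 3)$ are admitted.
\<close>
lemma coeff_eq_3:
  assumes pq: "prime p" "prime q" "prime r" "p \<ge> 7" "q = 2 * p - 1"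
    and rp: "[int r = 2] (mod int p)" and rq: "[int r = -4] (mod int q)" and r: "r > p + q + p * q"
  obtains n where "coeff (cyclotomic_poly (p * q * r)) n = 3"
proof -
  have "q > p" using pq by simp
  have "r > q" using r pq by simp
  then have ne: "p \<noteq> r" "q \<noteq> r" using \<open>q > p\<close> by auto
  define P Q where "P = int p" and "Q = int q"
  have Q: "Q = 2 * P - 1" using pq by (simp add: P_def Q_def)
  have P7: "P \<ge> 7" using pq by (simp add: P_def)
  obtain a where a: "int r = 2 + P * a" using rp
    by (metis P_def cong_iff_lin cong_sym)
  obtain b where b: "int r = -4 + Q * b" using rq
    by (metis Q_def cong_iff_lin cong_sym)
  have cop: "coprime P Q"
    unfolding P_def Q_def coprime_int_iff using pq(1,2) \<open>q > p\<close> by (intro primes_coprime) auto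
  have pQ: "Factorial_Ring.prime Q" unfolding Q_def using pq(2) by (simp only: prime_nat_int_transfer)
  \<comment> \<open>\<open>N\<close> is the largest exponent \<open>i\<close> that the bound \<open>r * i + m \<le> n\<close> will admit.\<close>
  define N where "N = 1 + p * (p - 3)"
  have N: "int N = 1 + P * (P - 3)" using P7 by (simp add: N_def P_def of_nat_diff)
  \<comment> \<open>The least number congruent to 2 modulo \<open>p * q\<close> that leaves room for \<open>m < p\<close> and for the shift by
    \<open>q\<close>.  As \<open>r > p + q + p * q\<close>, it lies below \<open>r * (N + 1)\<close>.\<close>
  define n where "n = 2 + p * q * ((r * N + p + q + p * q - 2) div (p * q))"
  have pq0: "p * q > 0" using pq by simp
  have n1: "n \<ge> r * N + p + q"
  proof -
    define X where "X = r * N + p + q + p * q - 2"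
    have "X < p * q * (X div (p * q)) + p * q"
      using pq0 by (metis mod_less_divisor mult_div_mod_eq nat_add_left_cancel_less)
    moreover have "X + 2 = r * N + p + q + p * q" using P7 by (simp add: X_def P_def)
    ultimately show ?thesis unfolding n_def X_def[symmetric] by linarith
  qed
  have n2: "n < r * (N + 1)"
  proof -
    define X where "X = r * N + p + q + p * q - 2"
    have "p * q * (X div (p * q)) \<le> X" by simp
    moreover have "X + 2 = r * N + p + q + p * q" using P7 by (simp add: X_def P_def)
    ultimately have "n \<le> r * N + p + q + p * q" unfolding n_def X_def[symmetric] by linarith
    also have "\<dots> < r * (N + 1)" using r by simp
    finally show ?thesis .
  qed
  obtain c where c: "int n = 2 + P * Q * c"
    unfolding n_def P_def Q_def by (metis of_nat_add of_nat_mult of_nat_numeral)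
  have qn: "q \<le> n" using n1 by simp
  have nq: "int (n - q) = 2 - Q + P * Q * c" using c qn by (simp add: of_nat_diff Q_def)
  have bound: "r * i + m \<le> n - q \<and> r * i + m \<le> n" if "i \<le> N" "m < p" for i m
  proof -
    have "r * i \<le> r * N" using that by simp
    moreover have "r * i + m + q \<le> r * N + p + q" using that calculation by linarith
    ultimately show ?thesis using n1 by linarith
  qed
  have bound': "i \<le> N" if "r * i + m \<le> n" for i m
  proof -
    have "r * i < r * (N + 1)" using that n2 by linarith
    then have "i < N + 1" by (rule mult_less_cancel1[THEN iffD1, THEN conjunct2])
    then show ?thesis by simp
  qed
  have dvdI: "int (p * q) dvd x" if "P dvd x" "Q dvd x" for x
    using divides_mult[OF that cop] by (simp add: P_def Q_def)
  have dvdD: "P dvd x" "Q dvd x" if "int (p * q) dvd x" for x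
    using that by (auto simp: P_def Q_def dest: dvd_mult_left dvd_mult_right)
  have card1: "card (hits p (p * q) r S k) = 1"
    if "(i, m) \<in> hits p (p * q) r S k" "card (hits p (p * q) r S k) \<le> 1" "finite S" for i m S k
    using that finite_hits[OF that(3), of p "p * q" r k] card_gt_0_iff[of "hits p (p * q) r S k"] by fastforce
  have fin: "finite (pos_support p q)" "finite (shifted_pos_support p q)" "finite (neg_support p q)"
    by (simp_all add: pos_support_def shifted_pos_support_def neg_support_def)
  note le1 = card_hits_support_le_1[OF pq(1-3) ne pq(5)]

  have a1: "card (hits p (p * q) r (pos_support p q) n) = 1"
  proof (rule card1[OF _ le1(1) fin(1)])
    show "(0, 2) \<in> hits p (p * q) r (pos_support p q) n"
    proof (rule hitsI)
      show "0 \<in> pos_support p q" using pq by (auto simp: pos_support_def)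
      show "int (p * q) dvd int r * int 0 + int 2 - int n"
        by (simp add: c P_def Q_def)
    qed (use bound[of 0 2] pq in auto)
  qed
  have b1: "card (hits p (p * q) r (shifted_pos_support p q) n) = 1"
  proof (rule card1[OF _ le1(2) fin(2)])
    show "(p + q * 1, 4) \<in> hits p (p * q) r (shifted_pos_support p q) n"
    proof (rule hitsI)
      show "p + q * 1 \<in> shifted_pos_support p q" unfolding shifted_pos_support_def using pq(4) by (intro imageI) simp
      have "P * 7 \<le> P * P" using P7 by (intro mult_left_mono) auto
      moreover have "P * (P - 3) = P * P - P * 3" by (rule right_diff_distrib)
      ultimately have "P + Q \<le> 1 + P * (P - 3)" using P7 Q by linarith
      then have "int (p + q * 1) \<le> int N" unfolding N by (simp add: P_def Q_def)
      then show "r * (p + q * 1) + 4 \<le> n" using bound[of "p + q * 1" 4] pq by simp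
      show "int (p * q) dvd int r * int (p + q * 1) + int 4 - int n"
      proof (rule dvdI)
        have "int r * int (p + q * 1) + int 4 - int n = P * (3 * int r - a - Q * c)"
          unfolding c using a by (simp add: P_def[symmetric] Q_def[symmetric] Q algebra_simps)
        then show "P dvd int r * int (p + q * 1) + int 4 - int n" by simp
        have "int r * int (p + q * 1) + int 4 - int n = Q * (int r + b * P - 2 - P * c)"
          unfolding c b by (simp add: P_def[symmetric] Q_def[symmetric] Q algebra_simps)
        then show "Q dvd int r * int (p + q * 1) + int 4 - int n" by simp
      qed
    qed (use pq in auto)
  qed
  have c1: "card (hits p (p * q) r (neg_support p q) (n - q)) = 1"
  proof (rule card1[OF _ le1(3) fin(3)])
    show "(N, 1) \<in> hits p (p * q) r (neg_support p q) (n - q)"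
    proof (rule hitsI)
      show "N \<in> neg_support p q" using pq by (auto simp: neg_support_def N_def)
      show "r * N + 1 \<le> n - q" using bound[of N 1] pq by simp
      show "int (p * q) dvd int r * int N + int 1 - int (n - q)"
      proof (rule dvdI)
        have "int r * int N + int 1 - int (n - q) = P * (a + int r * (P - 3) + 2 - Q * c)"
          unfolding nq N using a by (simp add: Q algebra_simps)
        then show "P dvd int r * int N + int 1 - int (n - q)" by simp
        have "int r * int N + int 1 - int (n - q) = Q * (b * (1 + P * (P - 3)) - 2 * P + 6 - P * c)"
          unfolding nq N b by (simp add: Q algebra_simps)
        then show "Q dvd int r * int N + int 1 - int (n - q)" by simp
      qed
    qed (use pq in auto)
  qed
  have c0: "hits p (p * q) r (neg_support p q) n = {}"
  proof (rule ccontr)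
    assume "hits p (p * q) r (neg_support p q) n \<noteq> {}"
    then obtain i m where h: "(i, m) \<in> hits p (p * q) r (neg_support p q) n" by auto
    note h = hitsD[OF this]
    obtain j where j: "i = 1 + p * j" "j < q - 2" using h(1) by (auto simp: neg_support_def)
    have i: "int i = 1 + P * int j" by (simp add: j P_def)
    have "P dvd int r * int i + int m - int n" using dvdD h(4) by blast
    also have "int r * int i + int m - int n = int m - 0 + P * (a + int r * int j - Q * c)"
      unfolding i c using a by (simp add: algebra_simps)
    finally have "P dvd int m - 0" by (simp add: dvd_add_left_iff)
    then have m: "int m = 0" using h(2) by (intro zdvd_range_eq[of P]) (auto simp: P_def)
    have "Q dvd int r * int i + int m - int n" using dvdD h(4) by blast
    also have "int r * int i + int m - int n = Q * (b * int i - 2 * int j - P * c) - 2 * (int j + 3)"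
      unfolding m c b i by (simp add: Q algebra_simps)
    finally have "Q dvd 2 * (int j + 3)" by (simp add: dvd_diff_right_iff)
    then have "Q dvd 2 \<or> Q dvd int j + 3" using pQ prime_dvd_mult_iff by blast
    moreover have "\<not> Q dvd 2" using P7 Q by (auto dest: zdvd_imp_le)
    ultimately have "Q dvd int j + 3" by simp
    then have "Q \<le> int j + 3" by (auto dest: zdvd_imp_le)
    then have "p \<le> j" using P7 Q by (simp add: P_def)
    then have "p * (p - 3) < p * j" using P7 by (intro mult_strict_left_mono) (auto simp: P_def)
    then have "N < i" by (simp add: N_def j)
    with bound'[OF h(3)] show False by simp
  qed
  have a0: "hits p (p * q) r (pos_support p q) (n - q) = {}"
  proof (rule ccontr)
    assume "hits p (p * q) r (pos_support p q) (n - q) \<noteq> {}"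
    then obtain i m where h: "(i, m) \<in> hits p (p * q) r (pos_support p q) (n - q)" by auto
    note h = hitsD[OF this]
    obtain y where y: "i = q * y" "y < p - 1" using h(1) by (auto simp: pos_support_def)
    have i: "int i = Q * int y" by (simp add: y Q_def)
    have "Q dvd int r * int i + int m - int (n - q)" using dvdD h(4) by blast
    also have "int r * int i + int m - int (n - q) = (int m - 2) + Q * (int r * int y + 1 - P * c)"
      unfolding i nq by (simp add: algebra_simps)
    finally have "Q dvd int m - 2" by (simp add: dvd_add_left_iff)
    then have m: "int m = 2" using h(2) P7 Q by (intro zdvd_range_eq[of Q]) (auto simp: P_def)
    have "P dvd int r * int i + int m - int (n - q)" using dvdD h(4) by blast
    also have "int r * int i + int m - int (n - q) = P * (a * Q * int y + 4 * int y + 2 - Q * c) - (2 * int y + 1)"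
      unfolding m nq i a by (simp add: Q algebra_simps)
    finally have "P dvd 2 * int y + 1" by (simp add: dvd_diff_right_iff)
    then obtain k where k: "2 * int y + 1 = P * k" by blast
    have "2 * int y + 1 < P * 2" using y(2) by (simp add: P_def)
    then have "P * k < P * 2" using k by simp
    then have "k < 2" using P7 by simp
    moreover have "P * k > 0" unfolding k[symmetric] by simp
    then have "k > 0" using P7 by (simp add: zero_less_mult_iff)
    ultimately have "k = 1" by simp
    then have k: "2 * int y = P - 1" using k by simp
    have "int i \<le> int N" using bound'[of i m] h(3) by simp
    then have "Q * (2 * int y) \<le> 2 * (1 + P * (P - 3))" unfolding N i by simp
    then show False unfolding k Q using P7 by (simp add: algebra_simps)
  qed
  have b0: "hits p (p * q) r (shifted_pos_support p q) (n - q) = {}"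
  proof (rule ccontr)
    assume "hits p (p * q) r (shifted_pos_support p q) (n - q) \<noteq> {}"
    then obtain i m where h: "(i, m) \<in> hits p (p * q) r (shifted_pos_support p q) (n - q)" by auto
    note h = hitsD[OF this]
    obtain y where y: "i = p + q * y" "y < p - 1" using h(1) by (auto simp: shifted_pos_support_def)
    have i: "int i = P + Q * int y" by (simp add: y Q_def P_def)
    have "Q dvd int r * int i + int m - int (n - q)" using dvdD h(4) by blast
    also have "int r * int i + int m - int (n - q) =
        (int m - 4) + Q * (int r * int y + b * P - 2 + 1 - P * c)"
    proof -
      have "int r * P = -2 - 2 * Q + b * P * Q" unfolding b by (simp add: Q algebra_simps)
      then show ?thesis unfolding i nq by (simp add: algebra_simps)
    qed
    finally have "Q dvd int m - 4" by (simp add: dvd_add_left_iff)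
    then have m: "int m = 4" using h(2) P7 Q by (intro zdvd_range_eq[of Q]) (auto simp: P_def)
    have "P dvd int r * int i + int m - int (n - q)" using dvdD h(4) by blast
    also have "int r * int i + int m - int (n - q) =
        P * (int r + a * Q * int y + 4 * int y + 2 - Q * c) - (2 * int y - 1)"
    proof -
      have "int r * (Q * int y) = P * (a * Q * int y + 4 * int y) - 2 * int y"
        unfolding a by (simp add: Q algebra_simps)
      then have "int r * int i = P * int r + P * (a * Q * int y + 4 * int y) - 2 * int y"
        unfolding i by (simp only: distrib_left mult.commute[of "int r" P])
      then show ?thesis unfolding m nq by (simp only: Q) (simp add: algebra_simps)
    qed
    finally have "P dvd 2 * int y - 1" by (simp add: dvd_diff_right_iff)
    then obtain k where k: "2 * int y - 1 = P * k" by blast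
    have "2 * int y - 1 < P * 2" using y(2) by (simp add: P_def)
    then have "P * k < P * 2" using k by simp
    then have "k < 2" using P7 by simp
    moreover have "P * k > P * (-1)" unfolding k[symmetric] using P7 by simp
    then have "k > -1" using P7 by (metis mult_less_cancel_left_pos less_le_trans zero_less_numeral)
    moreover have "k \<noteq> 0" using k by (auto, presburger)
    ultimately have "k = 1" by simp
    then have k: "2 * int y = P + 1" using k by simp
    have "int i \<le> int N" using bound'[of i m] h(3) by simp
    then have "2 * P + Q * (2 * int y) \<le> 2 * (1 + P * (P - 3))" unfolding N i by (simp add: algebra_simps)
    then show False unfolding k Q using P7 by (simp add: algebra_simps)
  qed
  have "coeff (cyclotomic_poly (p * q * r)) n = 3"
    unfolding coeff_cyclotomic_poly[OF pq(1-3) ne pq(5)] hit_count_def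
    using qn by (simp add: a1 b1 c1 a0 b0 c0)
  then show ?thesis by (rule that)
qed

section \<open>Dirichlet characters of squarefree modulus\<close>

text \<open>
  Characters are functions on all natural numbers, so that they can be used directly as coefficients of Dirichlet series.
\<close>
definition dchars :: "nat \<Rightarrow> (nat \<Rightarrow> complex) set" where
  "dchars m = {\<xi>. (\<forall>a b. \<xi> (a * b) = \<xi> a * \<xi> b) \<and> (\<forall>a b. [a = b] (mod m) \<longrightarrow> \<xi> a = \<xi> b) \<and>
     (\<forall>a. \<xi> a = 0 \<longleftrightarrow> \<not> coprime a m)}"

definition principal_dchar :: "nat \<Rightarrow> nat \<Rightarrow> complex" where
  "principal_dchar m = (\<lambda>a. of_bool (coprime a m))"

lemma dchars_mult: "\<xi> \<in> dchars m \<Longrightarrow> \<xi> (a * b) = \<xi> a * \<xi> b"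
  and dchars_cong: "\<xi> \<in> dchars m \<Longrightarrow> [a = b] (mod m) \<Longrightarrow> \<xi> a = \<xi> b"
  and dchars_eq_0_iff: "\<xi> \<in> dchars m \<Longrightarrow> \<xi> a = 0 \<longleftrightarrow> \<not> coprime a m"
  by (simp_all add: dchars_def)

lemma dchars_1: "\<xi> \<in> dchars m \<Longrightarrow> \<xi> 1 = 1"
  using dchars_mult[of \<xi> m 1 1] dchars_eq_0_iff[of \<xi> m 1] by simp

lemma dchars_power: "\<xi> \<in> dchars m \<Longrightarrow> \<xi> (a ^ k) = \<xi> a ^ k"
  by (induction k) (simp_all add: dchars_mult dchars_1[unfolded One_nat_def])

lemma dchars_root_of_unity:
  assumes "\<xi> \<in> dchars m" "coprime a m"
  shows "\<xi> a ^ totient m = 1"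
  using dchars_cong[OF assms(1) euler_theorem[OF assms(2)]] dchars_power[OF assms(1)] dchars_1[OF assms(1)]
  by simp

lemma cmod_dchars:
  assumes "\<xi> \<in> dchars m" "m > 0"
  shows "cmod (\<xi> a) = of_bool (coprime a m)"
proof (cases "coprime a m")
  case True
  have "cmod (\<xi> a) ^ totient m = 1"
    using dchars_root_of_unity[OF assms(1) True] by (metis norm_power norm_one)
  then have "cmod (\<xi> a) = 1"
    using assms(2) power_eq_1_iff[of "cmod (\<xi> a)" "totient m"] by simp
  with True show ?thesis by simp
qed (use dchars_eq_0_iff[OF assms(1)] in simp)

lemma cmod_dchars_le_1: "\<xi> \<in> dchars m \<Longrightarrow> m > 0 \<Longrightarrow> cmod (\<xi> a) \<le> 1"
  by (simp add: cmod_dchars)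

lemma finite_dchars:
  assumes "m > 0"
  shows "finite (dchars m)"
proof -
  let ?V = "insert 0 {z::complex. z ^ totient m = 1}"
  let ?r = "\<lambda>\<xi>. restrict \<xi> {..<m}"
  have "inj_on ?r (dchars m)"
  proof (rule inj_onI)
    fix \<xi> \<psi> assume c: "\<xi> \<in> dchars m" "\<psi> \<in> dchars m" and eq: "?r \<xi> = ?r \<psi>"
    show "\<xi> = \<psi>"
    proof
      fix a
      have "\<xi> (a mod m) = \<psi> (a mod m)" using fun_cong[OF eq, of "a mod m"] assms by simp
      then show "\<xi> a = \<psi> a"
        using dchars_cong[OF c(1), of "a mod m" a] dchars_cong[OF c(2), of "a mod m" a] by simp
    qed
  qed
  moreover have "?r ` dchars m \<subseteq> PiE {..<m} (\<lambda>_. ?V)"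
  proof (intro image_subsetI PiE_I)
    fix \<xi> a assume c: "\<xi> \<in> dchars m" and "a \<in> {..<m}"
    then show "?r \<xi> a \<in> ?V"
      using dchars_root_of_unity[OF c, of a] dchars_eq_0_iff[OF c, of a] by auto
  qed simp
  moreover have "finite (PiE {..<m} (\<lambda>_. ?V))"
    using assms by (intro finite_PiE) (auto intro: finite_roots_unity)
  ultimately show ?thesis by (meson finite_imageD finite_subset)
qed

lemma principal_dchar_in_dchars: "principal_dchar m \<in> dchars m"
  by (auto simp: dchars_def principal_dchar_def coprime_cong_cong_left)

lemma cnj_in_dchars:
  assumes "\<xi> \<in> dchars m"
  shows "(\<lambda>a. cnj (\<xi> a)) \<in> dchars m"
  using assms unfolding dchars_def by auto

lemma bij_betw_mult_mod:
  fixes b m :: nat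
  assumes "coprime b m" "m > 0"
  shows "bij_betw (\<lambda>k. b * k mod m) {..<m} {..<m}"
proof -
  have "inj_on (\<lambda>k. b * k mod m) {..<m}"
  proof (rule inj_onI)
    fix x y assume "x \<in> {..<m}" "y \<in> {..<m}" "b * x mod m = b * y mod m"
    then have "[b * x = b * y] (mod m)" "x < m" "y < m" by (simp_all add: cong_def)
    then show "x = y" using assms by (meson cong_less_imp_eq_nat cong_mult_lcancel_nat le0)
  qed
  moreover have "(\<lambda>k. b * k mod m) ` {..<m} \<subseteq> {..<m}" using assms by auto
  ultimately show ?thesis by (metis bij_betw_def endo_inj_surj finite_lessThan)
qed

text \<open>
  Multiplication by a $b$ with $\xi(b) \neq 1$ permutes the residues and scales the sum.
\<close>
lemma dchars_period_sum:
  assumes c: "\<xi> \<in> dchars m" and "m > 0" "\<xi> \<noteq> principal_dchar m"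
  shows "(\<Sum>k<m. \<xi> k) = 0"
proof -
  obtain b where b: "\<xi> b \<noteq> principal_dchar m b" using assms(3) by auto
  then have cop: "coprime b m" and ne: "\<xi> b \<noteq> 1"
    using dchars_eq_0_iff[OF c, of b] by (auto simp: principal_dchar_def split: if_splits)
  have "(\<Sum>k<m. \<xi> k) = (\<Sum>k<m. \<xi> (b * k mod m))"
    by (rule sum.reindex_bij_betw[OF bij_betw_mult_mod[OF cop \<open>m > 0\<close>], symmetric])
  also have "\<dots> = (\<Sum>k<m. \<xi> b * \<xi> k)"
    using dchars_cong[OF c] dchars_mult[OF c] by (intro sum.cong refl) (metis cong_mod_left cong_refl)
  also have "\<dots> = \<xi> b * (\<Sum>k<m. \<xi> k)" by (simp only: sum_distrib_left)
  finally have "(\<Sum>k<m. \<xi> k) = \<xi> b * (\<Sum>k<m. \<xi> k)" .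
  with ne show ?thesis by (metis mult_cancel_right1)
qed

lemma cmod_dchars_partial_sum_le:
  assumes c: "\<xi> \<in> dchars m" and "m > 0" "\<xi> \<noteq> principal_dchar m"
  shows "cmod (\<Sum>k<n. \<xi> k) \<le> m"
proof (induction n rule: less_induct)
  case (less n)
  show ?case
  proof (cases "n < m")
    case True
    have "cmod (\<Sum>k<n. \<xi> k) \<le> (\<Sum>k<n. 1)"
      by (intro sum_norm_le cmod_dchars_le_1[OF c \<open>m > 0\<close>])
    with True show ?thesis by simp
  next
    case False
    have "(\<Sum>k<n. \<xi> k) = (\<Sum>k<m. \<xi> k) + (\<Sum>k=m..<n. \<xi> k)"
      using False by (simp add: lessThan_atLeast0 sum.atLeastLessThan_concat)
    also have "(\<Sum>k=m..<n. \<xi> k) = (\<Sum>k<n - m. \<xi> (k + m))"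
      using False sum.shift_bounds_nat_ivl[of \<xi> 0 m "n - m"] by (simp add: lessThan_atLeast0)
    also have "\<dots> = (\<Sum>k<n - m. \<xi> k)"
      by (intro sum.cong refl dchars_cong[OF c]) (simp add: cong_def)
    finally show ?thesis using dchars_period_sum[OF assms] less.IH[of "n - m"] False assms(2) by simp
  qed
qed

lemma dchars_mult_closed:
  assumes "\<xi> \<in> dchars m" "\<psi> \<in> dchars m"
  shows "(\<lambda>a. \<xi> a * \<psi> a) \<in> dchars m"
  using assms unfolding dchars_def by (auto simp: mult_ac)

text \<open>
  For squarefree $m$ some prime $l$ dividing $m$ has $n \not\equiv 1 \pmod l$.  With a
  primitive root modulo $l$, the discrete logarithm followed by a primitive root of unity of order $l - 1$ is a
  character; it is $1$ only on the residue class of $1$ modulo $l$.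
\<close>
lemma dchars_separate:
  assumes "squarefree m" "m > 0" "coprime n m" "\<not> [n = 1] (mod m)"
  obtains \<xi> where "\<xi> \<in> dchars m" "\<xi> n \<noteq> 1"
proof -
  obtain l where l: "prime l" "l dvd m" "\<not> [n = 1] (mod l)"
  proof (rule ccontr)
    assume "\<not> thesis"
    with that have *: "[n = 1] (mod l)" if "prime l" "l dvd m" for l using \<open>prime l\<close> \<open>l dvd m\<close> by blast
    have "[n = 1] (mod (\<Prod>l\<in>prime_factors m. l))"
    proof (rule coprime_cong_prod_nat)
      fix i j assume "i \<in> prime_factors m" "j \<in> prime_factors m" "i \<noteq> j"
      then show "coprime i j" by (intro primes_coprime) (auto simp: in_prime_factors_iff)
    next
      fix i assume "i \<in> prime_factors m"
      then show "[n = 1] (mod i)" by (intro *) (auto simp: in_prime_factors_iff)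
    qed
    also have "(\<Prod>l\<in>prime_factors m. l) = m"
    proof -
      have "(\<Prod>l\<in>prime_factors m. l) = (\<Prod>l\<in>prime_factors m. l ^ multiplicity l m)"
        using assms(1,2) by (intro prod.cong refl)
          (auto simp: squarefree_factorial_semiring')
      then show ?thesis using prime_factorization_nat[OF assms(2)] by simp
    qed
    finally show False using assms(4) by simp
  qed
  obtain g where g: "residue_primroot l g" using prime_primitive_root_exists[OF prime_gt_1_nat[OF l(1)] l(1)] by blast
  define N where "N = totient l"
  have N: "N \<ge> 1" using l(1) prime_gt_0_nat[of l] unfolding N_def by (simp add: Suc_le_eq)
  have ord: "ord l g = N" using g by (simp add: residue_primroot_def N_def)
  have copg: "coprime l g" using g by (simp add: residue_primroot_def)
  define ind where "ind k = (SOME i. [g ^ i = k] (mod l))" for k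
  have ex: "\<exists>i. [g ^ i = k] (mod l)" if "coprime k m" for k
  proof -
    have "coprime k l" using that l(2) by (meson coprime_divisors dvd_refl)
    then have "k mod l \<in> totatives l" using l(1) prime_gt_1_nat[OF l(1)]
      by (auto simp: totatives_def intro!: Nat.gr0I) 
    then obtain i where "k mod l = g ^ i mod l"
      using residue_primroot_is_generator[OF _ g] prime_gt_1_nat[OF l(1)] unfolding bij_betw_def by blast
    then show ?thesis by (auto simp: cong_def)
  qed
  have ind: "[g ^ ind k = k] (mod l)" if "coprime k m" for k
    unfolding ind_def using ex[OF that] by (rule someI_ex)
  define e where "e i = exp (2 * of_real pi * \<i> * of_nat i / of_nat N)" for i :: nat
  have e1: "e i = 1 \<longleftrightarrow> N dvd i" for i
    unfolding e_def by (rule complex_root_unity_eq_1[OF N])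
  have e_add: "e (i + j) = e i * e j" for i j
    unfolding e_def by (simp add: exp_add[symmetric] add_divide_distrib distrib_left)
  have e_cong: "e i = e j" if "[i = j] (mod N)" for i j
    using that
  proof (induction i j rule: linorder_wlog)
    case (le i j)
    then obtain k where "j = i + k * N" by (metis cong_le_nat cong_sym_eq add.commute mult.commute)
    then show ?case using e1[of "k * N"] by (simp add: e_add)
  qed (simp add: cong_sym_eq)
  define \<xi> where "\<xi> k = (if coprime k m then e (ind k) else 0)" for k
  have "\<xi> \<in> dchars m"
    unfolding dchars_def
  proof (intro CollectI conjI allI impI)
    fix a b
    show "\<xi> (a * b) = \<xi> a * \<xi> b"
    proof (cases "coprime a m \<and> coprime b m")
      case True
      then have cab: "coprime (a * b) m" by simp
      have "[g ^ ind (a * b) = a * b] (mod l)" by (rule ind[OF cab])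
      also have "[a * b = g ^ ind a * g ^ ind b] (mod l)"
        using True by (intro cong_sym[OF cong_mult] ind) auto
      finally have "[g ^ ind (a * b) = g ^ (ind a + ind b)] (mod l)" by (simp add: power_add)
      then have "[ind (a * b) = ind a + ind b] (mod N)"
        using order_divides_expdiff[OF copg] ord by simp
      then show ?thesis using True cab e_cong by (simp add: \<xi>_def e_add)
    qed (auto simp: \<xi>_def)
  next
    fix a b assume ab: "[a = b] (mod m)"
    then have "coprime a m \<longleftrightarrow> coprime b m" by (simp add: coprime_cong_cong_left)
    moreover have "e (ind a) = e (ind b)" if "coprime a m" "coprime b m"
    proof -
      have "[a = b] (mod l)" using ab l(2) by (rule cong_dvd_modulus_nat)
      then have "[g ^ ind a = g ^ ind b] (mod l)" using ind that by (meson cong_sym cong_trans)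
      then show ?thesis using order_divides_expdiff[OF copg] ord e_cong by simp
    qed
    ultimately show "\<xi> a = \<xi> b" by (simp add: \<xi>_def)
  next
    fix a show "\<xi> a = 0 \<longleftrightarrow> \<not> coprime a m" by (simp add: \<xi>_def e_def)
  qed
  moreover have "\<xi> n \<noteq> 1"
  proof
    assume "\<xi> n = 1"
    then have "N dvd ind n" using assms(3) e1 by (simp add: \<xi>_def)
    then have "[g ^ ind n = 1] (mod l)" unfolding ord_divides ord .
    then show False using l(3) ind[OF assms(3)] by (meson cong_sym cong_trans)
  qed
  ultimately show ?thesis by (rule that)
qed

text \<open>
  Multiplication by a character $\psi$ with $\psi(n) \neq 1$ permutes the set of characters and scales
  the sum.
\<close>
lemma sum_dchars:
  assumes "squarefree m" "m > 0"
  shows "(\<Sum>\<xi>\<in>dchars m. \<xi> n) = of_nat (card (dchars m)) * of_bool ([n = 1] (mod m))"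
proof (cases "[n = 1] (mod m)")
  case True
  then have "(\<Sum>\<xi>\<in>dchars m. \<xi> n) = (\<Sum>\<xi>\<in>dchars m. 1)"
    using dchars_cong dchars_1 by (intro sum.cong refl) metis
  with True show ?thesis by simp
next
  case False
  show ?thesis
  proof (cases "coprime n m")
    case True
    then obtain \<psi> where \<psi>: "\<psi> \<in> dchars m" "\<psi> n \<noteq> 1" using dchars_separate assms False by blast
    have unit: "cnj (\<psi> a) * (\<psi> a * x) = x \<and> \<psi> a * (cnj (\<psi> a) * x) = x" if "coprime a m" for a x
    proof -
      have "\<psi> a * cnj (\<psi> a) = 1"
        using cmod_dchars[OF \<psi>(1) assms(2), of a] that by (simp add: complex_norm_square[symmetric])
      then show ?thesis by (simp add: mult.assoc[symmetric] mult.commute[of "cnj (\<psi> a)"])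
    qed
    have inv: "(\<lambda>a. cnj (\<psi> a) * (\<psi> a * \<xi> a)) = \<xi>" "(\<lambda>a. \<psi> a * (cnj (\<psi> a) * \<xi> a)) = \<xi>"
      if "\<xi> \<in> dchars m" for \<xi>
    proof -
      have "cnj (\<psi> a) * (\<psi> a * \<xi> a) = \<xi> a \<and> \<psi> a * (cnj (\<psi> a) * \<xi> a) = \<xi> a" for a
        using unit[of a] dchars_eq_0_iff[OF that, of a] by (cases "coprime a m") auto
      then show "(\<lambda>a. cnj (\<psi> a) * (\<psi> a * \<xi> a)) = \<xi>" "(\<lambda>a. \<psi> a * (cnj (\<psi> a) * \<xi> a)) = \<xi>"
        by auto
    qed
    have "(\<Sum>\<xi>\<in>dchars m. \<xi> n) = (\<Sum>\<xi>\<in>dchars m. \<psi> n * \<xi> n)"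
      by (rule sum.reindex_bij_witness[of _ "\<lambda>\<xi> a. \<psi> a * \<xi> a" "\<lambda>\<xi> a. cnj (\<psi> a) * \<xi> a"])
        (use \<psi>(1) True in \<open>auto simp: inv unit intro!: dchars_mult_closed cnj_in_dchars\<close>)
    also have "\<dots> = \<psi> n * (\<Sum>\<xi>\<in>dchars m. \<xi> n)" by (simp add: sum_distrib_left)
    finally have "(\<Sum>\<xi>\<in>dchars m. \<xi> n) = 0" using \<psi>(2) by (metis mult_cancel_right1)
    with False show ?thesis by simp
  next
    case nc: False
    with False show ?thesis using dchars_eq_0_iff by (simp add: sum.neutral)
  qed
qed

lemma sum_dchars_cnj:
  assumes "squarefree m" "m > 0" "coprime a m"
  shows "(\<Sum>\<xi>\<in>dchars m. cnj (\<xi> a) * \<xi> n) = of_nat (card (dchars m)) * of_bool ([n = a] (mod m))"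
proof -
  obtain b where b: "[a * b = 1] (mod m)" using cong_solve_coprime_nat[OF assms(3)] by auto
  have "cnj (\<xi> a) * \<xi> n = \<xi> (b * n)" if "\<xi> \<in> dchars m" for \<xi>
  proof -
    have "\<xi> a * \<xi> b = 1" using dchars_cong[OF that b] dchars_mult[OF that] dchars_1[OF that] by simp
    moreover have "cnj (\<xi> a) * \<xi> a = 1"
      using cmod_dchars[OF that assms(2), of a] assms(3)
      by (simp add: complex_norm_square[symmetric] mult.commute)
    ultimately have "cnj (\<xi> a) = \<xi> b" by (metis mult.assoc mult_1_left mult_1_right)
    then show ?thesis using dchars_mult[OF that] by simp
  qed
  then have "(\<Sum>\<xi>\<in>dchars m. cnj (\<xi> a) * \<xi> n) = (\<Sum>\<xi>\<in>dchars m. \<xi> (b * n))" by simp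
  also have "\<dots> = of_nat (card (dchars m)) * of_bool ([b * n = 1] (mod m))"
    by (rule sum_dchars[OF assms(1,2)])
  also have "[b * n = 1] (mod m) \<longleftrightarrow> [n = a] (mod m)"
  proof
    assume "[b * n = 1] (mod m)"
    then have "[a * (b * n) = a * 1] (mod m)" by (rule cong_scalar_left)
    moreover have "[a * b * n = 1 * n] (mod m)" using b by (rule cong_scalar_right)
    ultimately show "[n = a] (mod m)" by (metis cong_sym cong_trans mult.assoc mult_1 mult_1_right)
  next
    assume "[n = a] (mod m)"
    then have "[b * n = b * a] (mod m)" by (rule cong_scalar_left)
    with b show "[b * n = 1] (mod m)" by (metis cong_trans mult.commute)
  qed
  finally show ?thesis .
qed

section \<open>Dirichlet series of characters\<close>

text \<open>
  Dirichlet's test in quantitative form, by summation by parts.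
\<close>
lemma abel_summation_bound:
  fixes a :: "nat \<Rightarrow> complex" and f :: "nat \<Rightarrow> real"
  assumes B: "\<And>n. cmod (\<Sum>k<n. a k) \<le> B"
    and dec: "\<And>k. N \<le> k \<Longrightarrow> f (Suc k) \<le> f k" and pos: "\<And>k. N \<le> k \<Longrightarrow> 0 \<le> f k" and "N \<le> M"
  shows "cmod (\<Sum>k=N..<M. a k * of_real (f k)) \<le> 2 * B * f N"
proof -
  define A where "A n = (\<Sum>k<n. a k)" for n
  have "(\<Sum>k=N..<M. a k * of_real (f k)) =
      A M * of_real (f M) - A N * of_real (f N) + (\<Sum>k=N..<M. A (Suc k) * of_real (f k - f (Suc k)))"
    using \<open>N \<le> M\<close>
  proof (induction M rule: dec_induct)
    case (step M)
    have aM: "a M * of_real (f M) = A (Suc M) * of_real (f M) - A M * of_real (f M)"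
      by (simp add: A_def algebra_simps)
    show ?case using step.hyps by (simp add: step.IH aM) (simp add: algebra_simps)
  qed simp
  also have "cmod \<dots> \<le> B * f M + B * f N + (\<Sum>k=N..<M. B * (f k - f (Suc k)))"
  proof (intro order_trans[OF norm_triangle_ineq] order_trans[OF norm_triangle_ineq4] add_mono sum_norm_le)
    have AB: "cmod (A n) \<le> B" for n using B by (simp add: A_def)
    show "cmod (A M * of_real (f M)) \<le> B * f M"
      using AB pos[OF \<open>N \<le> M\<close>] by (simp add: norm_mult mult_right_mono)
    show "cmod (A N * of_real (f N)) \<le> B * f N"
      using AB pos[of N] by (simp add: norm_mult mult_right_mono)
    show "cmod (A (Suc k) * of_real (f k - f (Suc k))) \<le> B * (f k - f (Suc k))" if "k \<in> {N..<M}" for k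
    proof -
      have "f (Suc k) \<le> f k" using dec that by simp
      then show ?thesis unfolding norm_mult norm_of_real
        using AB by (simp add: mult_right_mono)
    qed
  qed
  also have "(\<Sum>k=N..<M. B * (f k - f (Suc k))) = B * (f N - f M)"
    using sum_Suc_diff'[OF \<open>N \<le> M\<close>, of "\<lambda>k. - f k"] by (simp add: sum_distrib_left[symmetric])
  also have "B * f M + B * f N + B * (f N - f M) = 2 * B * f N" by (simp add: algebra_simps)
  finally show ?thesis .
qed

lemma of_nat_powr_real: "of_nat n powr (- complex_of_real s) = of_real (real n powr - s)"
  using powr_of_real[of "real n" "-s"] by simp

definition L_series :: "(nat \<Rightarrow> complex) \<Rightarrow> complex \<Rightarrow> complex" where
  "L_series \<xi> z = (\<Sum>n. \<xi> n * of_nat n powr (- z))"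

text \<open>
  For $s > 1$ this is $-L'(s)$.
\<close>
definition log_series :: "(nat \<Rightarrow> complex) \<Rightarrow> complex \<Rightarrow> complex" where
  "log_series \<xi> z = (\<Sum>n. \<xi> n * of_real (ln (real n)) * of_nat n powr (- z))"

text \<open>
  For $s > 1$ this is $-L'(s) / L(s)$.
\<close>
definition mangoldt_series :: "(nat \<Rightarrow> complex) \<Rightarrow> complex \<Rightarrow> complex" where
  "mangoldt_series \<xi> z = (\<Sum>n. \<xi> n * mangoldt n * of_nat n powr (- z))"

lemma L_series_tail_bound:
  assumes c: "\<xi> \<in> dchars m" "m > 0" "\<xi> \<noteq> principal_dchar m" and s: "s > 0" and N: "N \<ge> 1" "N \<le> M"
  shows "cmod (\<Sum>k=N..<M. \<xi> k * of_nat k powr (- of_real s)) \<le> 2 * real m * real N powr - s"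
  unfolding of_nat_powr_real
  using N s by (intro abel_summation_bound cmod_dchars_partial_sum_le c powr_mono2') auto

lemma summable_L_series_nonprincipal:
  assumes c: "\<xi> \<in> dchars m" "m > 0" "\<xi> \<noteq> principal_dchar m" and s: "s > 0"
  shows "summable (\<lambda>k. \<xi> k * of_nat k powr (- of_real s))"
  unfolding summable_Cauchy
proof (intro allI impI)
  fix e :: real assume "e > 0"
  have "((\<lambda>N. real N powr - s) \<longlongrightarrow> 0) sequentially"
    using s by (intro tendsto_neg_powr filterlim_real_sequentially) simp
  from tendsto_mult_right_zero[OF this, of "2 * real m"]
  have "\<forall>\<^sub>F N in sequentially. 2 * real m * real N powr - s < e"
    using \<open>e > 0\<close> by (rule order_tendstoD(2))
  then obtain N0 where N0: "\<And>N. N \<ge> N0 \<Longrightarrow> 2 * real m * real N powr - s < e"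
    by (auto simp: eventually_sequentially)
  show "\<exists>N0. \<forall>N\<ge>N0. \<forall>M. cmod (sum (\<lambda>k. \<xi> k * of_nat k powr (- of_real s)) {N..<M}) < e"
  proof (intro exI allI impI)
    fix N M assume N: "max 1 N0 \<le> N"
    show "cmod (sum (\<lambda>k. \<xi> k * of_nat k powr (- of_real s)) {N..<M}) < e"
    proof (cases "N \<le> M")
      case True
      have "cmod (sum (\<lambda>k. \<xi> k * of_nat k powr (- of_real s)) {N..<M}) \<le> 2 * real m * real N powr - s"
        using N by (intro L_series_tail_bound[OF c s _ True]) simp
      also have "\<dots> < e" using N by (intro N0) simp
      finally show ?thesis .
    qed (use \<open>e > 0\<close> in simp)
  qed
qed

text \<open>
  The function $x \mapsto \log(x) / x$ decreases from $e < 3$ onwards, and $x^{1-s}$ decreases for $s \ge 1$.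
\<close>
lemma ln_powr_antimono:
  assumes "s \<ge> 1" "k \<ge> 3"
  shows "ln (real (Suc k)) * real (Suc k) powr - s \<le> ln (real k) * real k powr - s"
proof -
  have eq: "ln (real n) * real n powr - s = (ln (real n) / real n) * real n powr (1 - s)" if "n \<ge> 1" for n
    using that by (simp add: powr_diff powr_minus field_simps)
  have "exp 1 \<le> real k" using exp_le assms(2) by linarith
  then have "ln (real (Suc k)) / real (Suc k) \<le> ln (real k) / real k"
    by (intro ln_x_over_x_mono) auto
  moreover have "real (Suc k) powr (1 - s) \<le> real k powr (1 - s)"
    using assms by (intro powr_mono2') auto
  ultimately have "(ln (real (Suc k)) / real (Suc k)) * real (Suc k) powr (1 - s)
      \<le> (ln (real k) / real k) * real k powr (1 - s)"
    using assms by (intro mult_mono) auto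
  then show ?thesis using eq[of k] eq[of "Suc k"] assms(2) by linarith
qed

text \<open>
  The bound is uniform in $s$ and in the number of terms, so it passes both to the limit series and,
  by the mean value theorem, to differences of the partial sums of $L$.  Only the terms before $3$ are treated
  separately, as monotonicity starts there.
\<close>
lemma log_series_partial_bound:
  assumes c: "\<xi> \<in> dchars m" "m > 0" "\<xi> \<noteq> principal_dchar m" and s: "s \<ge> 1"
  shows "cmod (\<Sum>k<M. \<xi> k * of_real (ln (real k)) * of_nat k powr (- of_real s)) \<le> 2 * real m + 1"
proof -
  let ?f = "\<lambda>k. ln (real k) * real k powr - s"
  let ?g = "\<lambda>k. \<xi> k * of_real (?f k)"
  have g: "\<xi> k * of_real (ln (real k)) * of_nat k powr (- of_real s) = ?g k" for k
    by (simp add: of_nat_powr_real)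
  have le1: "?f k \<le> 1" if "k \<ge> 1" for k
  proof -
    have "?f k \<le> ln (real k) * real k powr - 1"
      using s that by (intro mult_left_mono powr_mono) auto
    also have "\<dots> = ln (real k) / real k" using that by (simp add: powr_minus field_simps)
    also have "\<dots> \<le> 1" using ln_bound[of "real k"] that by (simp add: divide_le_eq_1)
    finally show ?thesis .
  qed
  have small: "cmod (\<Sum>k<M. ?g k) \<le> 1" if "M \<le> 3" for M
  proof -
    have "cmod (\<Sum>k<M. ?g k) \<le> (\<Sum>k<M. cmod (?g k))" by (rule norm_sum)
    also have "\<dots> \<le> (\<Sum>k<3. cmod (?g k))" using that by (intro sum_mono2) auto
    also have "\<dots> = cmod (?g 2)" by (simp add: numeral_3_eq_3 numeral_2_eq_2)
    also have "\<dots> = cmod (\<xi> 2) * ?f 2" by (simp add: norm_mult)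
    also have "\<dots> \<le> 1 * 1"
      using cmod_dchars_le_1[OF c(1,2)] le1[of 2] by (intro mult_mono) auto
    finally show ?thesis by simp
  qed
  show ?thesis
  proof (cases "M \<le> 3")
    case True
    show ?thesis unfolding g using small[OF True] by simp
  next
    case False
    have "(\<Sum>k<M. ?g k) = (\<Sum>k<3. ?g k) + (\<Sum>k=3..<M. ?g k)"
      using False by (simp add: lessThan_atLeast0 sum.atLeastLessThan_concat)
    also have "cmod \<dots> \<le> cmod (\<Sum>k<3. ?g k) + cmod (\<Sum>k=3..<M. ?g k)" by (rule norm_triangle_ineq)
    also have "cmod (\<Sum>k=3..<M. ?g k) \<le> 2 * real m * ?f 3"
      using False s by (intro abel_summation_bound cmod_dchars_partial_sum_le c ln_powr_antimono) auto
    also have "\<dots> \<le> 2 * real m * 1" using le1[of 3] by (intro mult_left_mono) auto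
    also have "cmod (\<Sum>k<3. ?g k) \<le> 1" by (rule small) simp
    finally show ?thesis unfolding g by simp
  qed
qed

lemma has_field_derivative_L_term:
  "((\<lambda>z. c * of_nat n powr (- z)) has_field_derivative
     - (c * of_real (ln (real n)) * of_nat n powr (- z))) (at (z::complex) within S)"
proof (cases "n = 0")
  case False
  then have "Ln (of_nat n) = of_real (ln (real n))" using Ln_of_nat by simp
  moreover have "((\<lambda>z. of_nat n powr (- z)) has_field_derivative
      (Ln (of_nat n) * of_nat n powr (- z)) * (- 1)) (at z within S)"
    using False
    by (intro DERIV_chain2[OF has_field_derivative_powr_right]) (auto intro!: derivative_eq_intros)
  ultimately show ?thesis
    by (auto intro: DERIV_cong[OF DERIV_cmult])
qed simp

text \<open>
  Continuity at $1$ from the right, where $L(1)$ is only conditionally convergent.  The partial sums satisfy the estimate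
  because their derivatives are uniformly bounded on the segment from $1$ to $s$.
\<close>
lemma L_series_lipschitz:
  assumes c: "\<xi> \<in> dchars m" "m > 0" "\<xi> \<noteq> principal_dchar m" and s: "s \<ge> 1"
  shows "cmod (L_series \<xi> (of_real s) - L_series \<xi> 1) \<le> (2 * real m + 1) * (s - 1)"
proof -
  let ?t = "\<lambda>k z. \<xi> k * of_nat k powr (- z)"
  have part: "cmod ((\<Sum>k<M. ?t k (of_real s)) - (\<Sum>k<M. ?t k 1)) \<le> (2 * real m + 1) * (s - 1)" for M
  proof -
    let ?S = "closed_segment (1::complex) (of_real s)"
    have "cmod ((\<Sum>k<M. ?t k (of_real s)) - (\<Sum>k<M. ?t k 1)) \<le> (2 * real m + 1) * cmod (of_real s - 1)"
    proof (rule field_differentiable_bound[of ?S])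
      fix z assume "z \<in> ?S"
      show "((\<lambda>z. \<Sum>k<M. ?t k z) has_field_derivative
        (\<Sum>k<M. - (\<xi> k * of_real (ln (real k)) * of_nat k powr (- z)))) (at z within ?S)"
        by (intro derivative_intros has_field_derivative_L_term)
      obtain t where t: "z = of_real t" "t \<ge> 1"
      proof -
        from \<open>z \<in> ?S\<close> obtain u where u: "0 \<le> u" "u \<le> 1" "z = (1 - u) *\<^sub>R 1 + u *\<^sub>R of_real s"
          by (auto simp: in_segment)
        have "z = of_real (1 + u * (s - 1))" unfolding u(3) by (simp add: scaleR_conv_of_real algebra_simps)
        moreover have "1 + u * (s - 1) \<ge> 1" using u s by simp
        ultimately show thesis by (rule that)
      qed
      show "cmod (\<Sum>k<M. - (\<xi> k * of_real (ln (real k)) * of_nat k powr (- z))) \<le> 2 * real m + 1"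
        unfolding sum_negf norm_minus_cancel t(1) by (rule log_series_partial_bound[OF c t(2)])
    qed auto
    also have "cmod (of_real s - 1) = s - 1"
      using s by (metis abs_of_nonneg diff_ge_0_iff_ge norm_of_real of_real_1 of_real_diff)
    finally show ?thesis .
  qed
  have "(\<lambda>M. \<Sum>k<M. ?t k (of_real s)) \<longlonglongrightarrow> L_series \<xi> (of_real s)"
    unfolding L_series_def using s by (intro summable_LIMSEQ summable_L_series_nonprincipal[OF c]) auto
  moreover have "(\<lambda>M. \<Sum>k<M. ?t k 1) \<longlonglongrightarrow> L_series \<xi> 1"
    unfolding L_series_def using summable_L_series_nonprincipal[OF c, of 1] by (intro summable_LIMSEQ) simp
  ultimately have "(\<lambda>M. cmod ((\<Sum>k<M. ?t k (of_real s)) - (\<Sum>k<M. ?t k 1))) \<longlonglongrightarrow>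
      cmod (L_series \<xi> (of_real s) - L_series \<xi> 1)"
    by (intro tendsto_intros)
  then show ?thesis by (rule LIMSEQ_le_const2) (intro exI allI impI part)
qed

lemma summable_ln_powr:
  assumes "s > 1"
  shows "summable (\<lambda>n. ln (real n) * real n powr - s)"
proof (rule summable_comparison_test')
  define d where "d = (s - 1) / 2"
  have d: "d > 0" "d - s < -1" using assms by (simp_all add: d_def field_simps)
  show "summable (\<lambda>n. (1 / d) * real n powr (d - s))"
    using d(2) by (intro summable_mult) (simp only: summable_real_powr_iff)
  fix n :: nat assume n: "n \<ge> 1"
  have "ln (real n) * real n powr - s \<le> (real n powr d / d) * real n powr - s"
    using n d by (intro mult_right_mono ln_powr_bound) auto
  also have "\<dots> = (1 / d) * real n powr (d - s)" by (simp add: powr_diff powr_minus divide_simps)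
  finally show "norm (ln (real n) * real n powr - s) \<le> (1 / d) * real n powr (d - s)"
    using n by simp
qed

lemma norm_of_nat_powr: "norm (of_nat n powr (- z) :: complex) = real n powr - Re z" 
  by (cases "n = 0") (simp_all add: norm_powr_real_powr)

lemma L_series_derivative:
  assumes c: "\<xi> \<in> dchars m" "m > 0" and s: "Re z > 1"
  shows "(L_series \<xi> has_field_derivative - log_series \<xi> z) (at z)"
proof -
  define \<sigma> where "\<sigma> = (1 + Re z) / 2"
  have \<sigma>: "1 < \<sigma>" "\<sigma> < Re z" using s by (auto simp: \<sigma>_def)
  define S where "S = {w. Re w > \<sigma>}"
  let ?f = "\<lambda>n w. \<xi> n * of_nat n powr (- w)"
  let ?f' = "\<lambda>n w. - (\<xi> n * of_real (ln (real n)) * of_nat n powr (- w))"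
  have S: "open S" "convex S" "z \<in> S"
    using \<sigma> by (auto simp: S_def open_halfspace_Re_gt convex_halfspace_Re_gt)
  have "uniformly_convergent_on S (\<lambda>n w. \<Sum>i<n. ?f' i w)"
  proof (rule Weierstrass_m_test'_ev)
    show "\<forall>\<^sub>F n in sequentially. \<forall>w\<in>S. norm (?f' n w) \<le> ln (real n) * real n powr - \<sigma>"
    proof (rule eventually_sequentiallyI[of 1], rule ballI)
      fix n w assume n: "n \<ge> (1::nat)" and w: "w \<in> S"
      have "norm (?f' n w) = cmod (\<xi> n) * (ln (real n) * real n powr - Re w)"
        using n by (simp add: norm_mult norm_of_nat_powr)
      also have "\<dots> \<le> 1 * (ln (real n) * real n powr - \<sigma>)"
        using n w cmod_dchars_le_1[OF c] by (intro mult_mono powr_mono) (auto simp: S_def)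
      finally show "norm (?f' n w) \<le> ln (real n) * real n powr - \<sigma>" by simp
    qed
    show "summable (\<lambda>n. ln (real n) * real n powr - \<sigma>)" by (rule summable_ln_powr[OF \<sigma>(1)])
  qed
  moreover have "summable (\<lambda>n. ?f n z)"
  proof (rule summable_comparison_test')
    show "summable (\<lambda>n. real n powr - Re z)" using s by (simp add: summable_real_powr_iff)
    fix n :: nat
    show "norm (?f n z) \<le> real n powr - Re z"
      using mult_right_mono[OF cmod_dchars_le_1[OF c, of n], of "real n powr - Re z"]
      by (simp add: norm_mult norm_of_nat_powr)
  qed
  ultimately have "((\<lambda>w. \<Sum>n. ?f n w) has_field_derivative (\<Sum>n. ?f' n z)) (at z)"
    using S by (intro has_field_derivative_series'(2)[of S ?f ?f' z]) 
      (auto simp: interior_open intro: has_field_derivative_L_term)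
  moreover have "(\<Sum>n. ?f' n z) = - log_series \<xi> z"
    unfolding log_series_def
  proof (rule suminf_minus)
    show "summable (\<lambda>n. \<xi> n * of_real (ln (real n)) * of_nat n powr (- z))"
    proof (rule summable_comparison_test')
      show "summable (\<lambda>n. ln (real n) * real n powr - Re z)" using s by (rule summable_ln_powr)
      fix n :: nat assume "n \<ge> 1"
      then show "norm (\<xi> n * of_real (ln (real n)) * of_nat n powr (- z)) \<le> ln (real n) * real n powr - Re z"
        using mult_right_mono[OF cmod_dchars_le_1[OF c, of n], of "ln (real n) * real n powr - Re z"]
        by (simp add: norm_mult norm_of_nat_powr mult.assoc)
    qed
  qed
  ultimately show ?thesis unfolding L_series_def[abs_def] by simp
qed

text \<open>
  Summing over all pairs $(d, k)$ either by rows or by the product $n = dk$.  This one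
  rearrangement yields both the convolution identity for $\Lambda$ and the power series of a Lambert series.
\<close>
lemma has_sum_divisors:
  fixes F :: "nat \<times> nat \<Rightarrow> complex"
  assumes F: "F summable_on {1..} \<times> {1..}"
    and R: "\<And>d. d \<ge> 1 \<Longrightarrow> ((\<lambda>k. F (d, k)) has_sum R d) {1..}"
  obtains S where "(R has_sum S) {1..}" "((\<lambda>n. \<Sum>d | d dvd n. F (d, n div d)) has_sum S) {1..}"
proof
  let ?S = "infsum F ({1..} \<times> {1..})"
  have S: "(F has_sum ?S) ({1..} \<times> {1..})" using F by (rule has_sum_infsum)
  then show "(R has_sum ?S) {1..}" by (rule has_sum_SigmaD) (use R in auto)
  have "((\<lambda>(n, d). F (d, n div d)) has_sum ?S) (Sigma {1..} (\<lambda>n. {d. d dvd n}))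
      \<longleftrightarrow> (F has_sum ?S) ({1..} \<times> {1..})"
    by (rule has_sum_reindex_bij_witness[of _ "\<lambda>(d, k). (d * k, d)" "\<lambda>(n, d). (d, n div d)"])
      (auto elim!: dvdE simp: Suc_le_eq)
  with S have "((\<lambda>(n, d). F (d, n div d)) has_sum ?S) (Sigma {1..} (\<lambda>n. {d. d dvd n}))" by simp
  then show "((\<lambda>n. \<Sum>d | d dvd n. F (d, n div d)) has_sum ?S) {1..}"
    by (rule has_sum_SigmaD) (auto intro!: has_sum_finite finite_divisors_nat simp: Suc_le_eq)
qed

lemma has_sum_from_1:
  fixes f :: "nat \<Rightarrow> 'a::banach"
  assumes "summable (\<lambda>n. norm (f n))" "f 0 = 0"
  shows "(f has_sum suminf f) {1..}"
proof -
  have "(f has_sum suminf f) UNIV"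
    using assms(1) by (intro norm_summable_imp_has_sum) (auto intro: summable_sums summable_norm_cancel)
  moreover have "(f has_sum suminf f) UNIV \<longleftrightarrow> (f has_sum suminf f) {1..}"
    using assms(2) by (intro has_sum_cong_neutral) (auto simp: Suc_le_eq)
  ultimately show ?thesis by simp
qed

lemma sums_from_1:
  fixes f :: "nat \<Rightarrow> 'a::banach"
  assumes "(f has_sum S) {1..}" "f 0 = 0"
  shows "f sums S"
proof -
  have "(f has_sum S) UNIV \<longleftrightarrow> (f has_sum S) {1..}"
    using assms(2) by (intro has_sum_cong_neutral) (auto simp: Suc_le_eq)
  with assms(1) show ?thesis by (intro has_sum_imp_sums) simp
qed

lemma dirichlet_product:
  fixes f g :: "nat \<Rightarrow> complex"
  assumes f: "summable (\<lambda>n. norm (f n))" "f 0 = 0" and g: "summable (\<lambda>n. norm (g n))" "g 0 = 0"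
  shows "((\<lambda>n. \<Sum>d | d dvd n. f d * g (n div d)) has_sum suminf f * suminf g) {1..}"
proof -
  note hf = has_sum_from_1[OF f] and hg = has_sum_from_1[OF g]
  have nf: "((\<lambda>n. norm (f n)) has_sum (\<Sum>n. norm (f n))) {1..}"
    and ng: "((\<lambda>n. norm (g n)) has_sum (\<Sum>n. norm (g n))) {1..}"
    using f g by (intro has_sum_from_1; simp)+
  define F where "F = (\<lambda>(d, k). f d * g k)"
  have "(\<lambda>x. norm (F x)) summable_on {1..} \<times> {1..}"
    unfolding Infinite_Sum.abs_summable_on_Sigma_iff
  proof (intro conjI ballI)
    have row: "((\<lambda>k. norm (F (d, k))) has_sum norm (f d) * (\<Sum>n. norm (g n))) {1..}" for d
      using has_sum_cmult_right[OF ng, of "norm (f d)"] by (simp add: F_def norm_mult)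
    show "(\<lambda>k. norm (F (d, k))) summable_on {1..}" for d
      using row by (rule has_sum_imp_summable)
    have "(\<Sum>n. norm (g n)) \<ge> 0" using g by (intro suminf_nonneg) auto
    then have "(\<lambda>d. norm (\<Sum>\<^sub>\<infinity>k\<in>{1..}. norm (F (d, k)))) = (\<lambda>d. norm (f d) * (\<Sum>n. norm (g n)))"
      unfolding infsumI[OF row] by (simp add: abs_mult)
    moreover have "((\<lambda>d. norm (f d) * (\<Sum>n. norm (g n))) has_sum (\<Sum>n. norm (f n)) * (\<Sum>n. norm (g n))) {1..}"
      by (rule has_sum_cmult_left[OF nf])
    ultimately show "(\<lambda>d. norm (\<Sum>\<^sub>\<infinity>k\<in>{1..}. norm (F (d, k)))) summable_on {1..}"
      by (simp only: has_sum_imp_summable)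
  qed
  then have "F summable_on {1..} \<times> {1..}" by (rule abs_summable_summable)
  moreover have "((\<lambda>k. F (d, k)) has_sum f d * suminf g) {1..}" for d
    unfolding F_def prod.case by (rule has_sum_cmult_right[OF hg])
  ultimately obtain S where S: "((\<lambda>d. f d * suminf g) has_sum S) {1..}"
      "((\<lambda>n. \<Sum>d | d dvd n. F (d, n div d)) has_sum S) {1..}"
    by (rule has_sum_divisors)
  have "S = suminf f * suminf g"
    using has_sum_unique[OF S(1) has_sum_cmult_left[OF hf]] by simp
  with S(2) show ?thesis by (simp add: F_def)
qed

lemma summable_norm_L_series:
  assumes c: "\<xi> \<in> dchars m" "m > 0" and s: "Re z > 1"
  shows "summable (\<lambda>n. norm (\<xi> n * of_nat n powr (- z)))"
proof (rule summable_comparison_test')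
  show "summable (\<lambda>n. real n powr - Re z)" using s by (simp add: summable_real_powr_iff)
  show "norm (norm (\<xi> n * of_nat n powr (- z))) \<le> real n powr - Re z" for n
    using mult_right_mono[OF cmod_dchars_le_1[OF c, of n], of "real n powr - Re z"]
    by (simp add: norm_mult norm_of_nat_powr)
qed

lemma mangoldt_powr_le: "mangoldt n * real n powr s \<le> ln (real n) * real n powr s"
  using mangoldt_le[of n] by (cases "n = 0") (auto intro: mult_right_mono)

lemma summable_norm_mangoldt_series:
  assumes c: "\<xi> \<in> dchars m" "m > 0" and s: "Re z > 1"
  shows "summable (\<lambda>n. norm (\<xi> n * mangoldt n * of_nat n powr (- z)))"
proof (rule summable_comparison_test')
  show "summable (\<lambda>n. ln (real n) * real n powr - Re z)" using s by (rule summable_ln_powr)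
  fix n
  have "norm (\<xi> n * mangoldt n * of_nat n powr (- z)) = cmod (\<xi> n) * (mangoldt n * real n powr - Re z)"
    by (simp add: norm_mult norm_of_nat_powr)
  also have "\<dots> \<le> 1 * (ln (real n) * real n powr - Re z)"
    by (rule mult_mono[OF cmod_dchars_le_1[OF c] mangoldt_powr_le]) (auto simp: mangoldt_nonneg)
  finally show "norm (norm (\<xi> n * mangoldt n * of_nat n powr (- z))) \<le> ln (real n) * real n powr - Re z"
    by simp
qed

text \<open>
  Convolution turns $\sum_{d \mid n} \Lambda(d) = \log n$ into an identity of Dirichlet
  series.
\<close>
lemma L_series_mangoldt_series:
  assumes c: "\<xi> \<in> dchars m" "m > 0" and s: "Re z > 1"
  shows "L_series \<xi> z * mangoldt_series \<xi> z = log_series \<xi> z"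
proof -
  let ?g = "\<lambda>n. \<xi> n * of_nat n powr (- z)"
  let ?f = "\<lambda>n. \<xi> n * mangoldt n * of_nat n powr (- z)"
  have hs: "((\<lambda>n. \<Sum>d | d dvd n. ?f d * ?g (n div d)) has_sum suminf ?f * suminf ?g) {1..}"
    by (intro dirichlet_product summable_norm_L_series[OF c s] summable_norm_mangoldt_series[OF c s]) auto
  have eq: "(\<Sum>d | d dvd n. ?f d * ?g (n div d)) = \<xi> n * of_real (ln (real n)) * of_nat n powr (- z)"
    if "n \<in> {1..}" for n
  proof -
    have "?f d * ?g (n div d) = \<xi> n * of_nat n powr (- z) * mangoldt d" if dn: "d dvd n" for d
    proof -
      obtain k where k: "n = d * k" using dn by (rule dvdE)
      with \<open>n \<in> {1..}\<close> have "d > 0" by (auto intro: Nat.gr0I)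
      then have "n div d = k" by (simp add: k)
      moreover have "of_nat n powr (- z) = of_nat d powr (- z) * of_nat k powr (- z)"
        unfolding k of_nat_mult by (rule powr_times_real) auto
      ultimately show ?thesis using dchars_mult[OF c(1), of d k] by (simp add: k)
    qed
    then have "(\<Sum>d | d dvd n. ?f d * ?g (n div d)) = (\<Sum>d | d dvd n. \<xi> n * of_nat n powr (- z) * mangoldt d)"
      by (intro sum.cong refl) blast
    also have "\<dots> = \<xi> n * of_nat n powr (- z) * (\<Sum>d | d dvd n. mangoldt d)"
      by (rule sum_distrib_left[symmetric])
    finally have "(\<Sum>d | d dvd n. ?f d * ?g (n div d)) = \<xi> n * of_nat n powr (- z) * (\<Sum>d | d dvd n. mangoldt d)" .
    then show ?thesis using mangoldt_sum[of n, where 'a = complex] that by (simp add: mult_ac)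
  qed
  have "((\<lambda>n. \<xi> n * of_real (ln (real n)) * of_nat n powr (- z)) has_sum suminf ?f * suminf ?g) {1..}"
    by (rule has_sum_cong[THEN iffD1, OF eq hs])
  then have "(\<lambda>n. \<xi> n * of_real (ln (real n)) * of_nat n powr (- z)) sums (suminf ?f * suminf ?g)"
    by (rule sums_from_1) simp
  then show ?thesis
    by (simp add: L_series_def mangoldt_series_def log_series_def sums_iff mult.commute)
qed

text \<open>
  The part of $\sum \Lambda(n) n^{-s}$ that comes from a single residue class.
\<close>
definition class_mangoldt :: "nat \<Rightarrow> nat \<Rightarrow> real \<Rightarrow> real" where
  "class_mangoldt m a s = (\<Sum>n. of_bool ([n = a] (mod m)) * mangoldt n * real n powr - s)"

lemma summable_class_mangoldt:
  assumes "s > 1"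
  shows "summable (\<lambda>n. of_bool ([n = a] (mod m)) * mangoldt n * real n powr - s)"
proof (rule summable_comparison_test')
  show "summable (\<lambda>n. ln (real n) * real n powr - s)" using assms by (rule summable_ln_powr)
  show "norm (of_bool ([n = a] (mod m)) * mangoldt n * real n powr - s) \<le> ln (real n) * real n powr - s" for n
    using mangoldt_powr_le[of n "- s"] mangoldt_nonneg[of n] by (cases "n = 0") (auto simp: of_bool_def)
qed

lemma class_mangoldt_nonneg: "s > 1 \<Longrightarrow> class_mangoldt m a s \<ge> 0"
  unfolding class_mangoldt_def by (intro suminf_nonneg summable_class_mangoldt) (auto simp: mangoldt_nonneg)

lemma sum_mangoldt_series:
  assumes "squarefree m" "m > 0" "coprime a m" "s > 1"
  shows "(\<Sum>\<xi>\<in>dchars m. cnj (\<xi> a) * mangoldt_series \<xi> (of_real s)) =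
    of_real (card (dchars m) * class_mangoldt m a s)"
proof -
  let ?f = "\<lambda>\<xi> n. \<xi> n * mangoldt n * of_nat n powr (- of_real s)"
  have sm: "summable (?f \<xi>)" if "\<xi> \<in> dchars m" for \<xi>
    by (rule summable_norm_cancel[OF summable_norm_mangoldt_series[OF that assms(2)]])
      (use assms(4) in simp)
  have "(\<Sum>\<xi>\<in>dchars m. cnj (\<xi> a) * mangoldt_series \<xi> (of_real s)) =
      (\<Sum>\<xi>\<in>dchars m. \<Sum>n. cnj (\<xi> a) * ?f \<xi> n)"
    unfolding mangoldt_series_def by (intro sum.cong refl suminf_mult[symmetric] sm)
  also have "\<dots> = (\<Sum>n. \<Sum>\<xi>\<in>dchars m. cnj (\<xi> a) * ?f \<xi> n)"
    by (intro suminf_sum[symmetric] summable_mult sm)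
  also have "(\<lambda>n. \<Sum>\<xi>\<in>dchars m. cnj (\<xi> a) * ?f \<xi> n) =
      (\<lambda>n. complex_of_real (card (dchars m) * (of_bool ([n = a] (mod m)) * mangoldt n * real n powr - s)))"
  proof
    fix n
    have "(\<Sum>\<xi>\<in>dchars m. cnj (\<xi> a) * ?f \<xi> n) =
        (\<Sum>\<xi>\<in>dchars m. cnj (\<xi> a) * \<xi> n) * (mangoldt n * of_nat n powr (- of_real s))"
      unfolding sum_distrib_right by (intro sum.cong refl) (simp only: mult_ac)
    then show "(\<Sum>\<xi>\<in>dchars m. cnj (\<xi> a) * ?f \<xi> n) =
      complex_of_real (card (dchars m) * (of_bool ([n = a] (mod m)) * mangoldt n * real n powr - s))"
      unfolding sum_dchars_cnj[OF assms(1-3)] of_nat_powr_real by simp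
  qed
  also have "(\<Sum>n. complex_of_real (card (dchars m) * (of_bool ([n = a] (mod m)) * mangoldt n * real n powr - s)))
     = of_real (card (dchars m) * class_mangoldt m a s)"
    unfolding class_mangoldt_def using summable_class_mangoldt[OF assms(4), of a m]
    by (subst suminf_of_real[symmetric]) (auto simp: suminf_mult intro: summable_mult)
  finally show ?thesis .
qed


section \<open>At most one L-series vanishes at 1\<close>

text \<open>
  The logarithmic derivative of $|G|^2$ along the real line is $2\,\mathrm{Re}\, g$.  Zeros
  of $G$ do no harm since only $G' = gG$ is used.
\<close>
lemma cmod_exponential_growth:
  assumes G: "\<And>x. s \<le> x \<Longrightarrow> x \<le> t \<Longrightarrow> (G has_field_derivative g x * G (of_real x)) (at (of_real x))"
    and st: "s \<le> t"
  shows "(\<And>x. s \<le> x \<Longrightarrow> x \<le> t \<Longrightarrow> Re (g x) \<le> 0) \<Longrightarrow> cmod (G (of_real t)) \<le> cmod (G (of_real s))"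
    and "(\<And>x. s \<le> x \<Longrightarrow> x \<le> t \<Longrightarrow> Re (g x) \<ge> 0) \<Longrightarrow> cmod (G (of_real s)) \<le> cmod (G (of_real t))"
proof -
  let ?u = "\<lambda>x. (cmod (G (of_real x)))\<^sup>2"
  have u: "(?u has_real_derivative 2 * Re (g x) * ?u x) (at x)" if "s \<le> x" "x \<le> t" for x
  proof -
    have v: "((\<lambda>x. G (of_real x)) has_vector_derivative g x * G (of_real x)) (at x)"
      using G[OF that] by (rule has_vector_derivative_real_field)
    have re: "((\<lambda>x. Re (G (of_real x))) has_real_derivative Re (g x * G (of_real x))) (at x)"
      using bounded_linear.has_vector_derivative[OF bounded_linear_Re v]
      by (simp add: has_real_derivative_iff_has_vector_derivative)
    have im: "((\<lambda>x. Im (G (of_real x))) has_real_derivative Im (g x * G (of_real x))) (at x)"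
      using bounded_linear.has_vector_derivative[OF bounded_linear_Im v]
      by (simp add: has_real_derivative_iff_has_vector_derivative)
    show ?thesis
      unfolding cmod_power2
      by (rule DERIV_cong[OF DERIV_add[OF DERIV_power[OF re, of 2] DERIV_power[OF im, of 2]]])
        (simp add: power2_eq_square algebra_simps)
  qed
  {
    assume "\<And>x. s \<le> x \<Longrightarrow> x \<le> t \<Longrightarrow> Re (g x) \<le> 0"
    then have "?u t \<le> ?u s"
      by (intro DERIV_nonpos_imp_nonincreasing[OF st]) (use u in \<open>blast intro: mult_nonpos_nonneg mult_nonneg_nonpos zero_le_power2 zero_le_numeral\<close>)
    then show "cmod (G (of_real t)) \<le> cmod (G (of_real s))" by (rule power2_le_imp_le) simp
  next
    assume "\<And>x. s \<le> x \<Longrightarrow> x \<le> t \<Longrightarrow> Re (g x) \<ge> 0"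
    then have "?u s \<le> ?u t"
      by (intro DERIV_nonneg_imp_nondecreasing[OF st]) (use u in \<open>blast intro: mult_nonneg_nonneg zero_le_power2 zero_le_numeral\<close>)
    then show "cmod (G (of_real s)) \<le> cmod (G (of_real t))" by (rule power2_le_imp_le) simp
  }
qed

definition L_prod :: "nat \<Rightarrow> complex \<Rightarrow> complex" where
  "L_prod m z = (\<Prod>\<xi>\<in>dchars m. L_series \<xi> z)"

text \<open>
  The product rule with $-L' = L \cdot H$; by orthogonality the sum of all $H$ is a nonnegative multiple of a series over
  the residue class of $1$.
\<close>
lemma L_prod_derivative:
  assumes "squarefree m" "m > 0" "s > 1"
  shows "(L_prod m has_field_derivative
     - of_real (card (dchars m) * class_mangoldt m 1 s) * L_prod m (of_real s)) (at (of_real s))"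
proof -
  let ?z = "complex_of_real s"
  have "(L_prod m has_field_derivative
      (\<Sum>\<xi>\<in>dchars m. - log_series \<xi> ?z * (\<Prod>\<psi>\<in>dchars m - {\<xi>}. L_series \<psi> ?z))) (at ?z)"
    unfolding L_prod_def[abs_def]
    using assms by (intro has_field_derivative_prod L_series_derivative) auto
  also have "(\<Sum>\<xi>\<in>dchars m. - log_series \<xi> ?z * (\<Prod>\<psi>\<in>dchars m - {\<xi>}. L_series \<psi> ?z)) =
      (\<Sum>\<xi>\<in>dchars m. - mangoldt_series \<xi> ?z * L_prod m ?z)"
  proof (intro sum.cong refl)
    fix \<xi> assume c: "\<xi> \<in> dchars m"
    have "L_prod m ?z = L_series \<xi> ?z * (\<Prod>\<psi>\<in>dchars m - {\<xi>}. L_series \<psi> ?z)"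
      unfolding L_prod_def by (rule prod.remove[OF finite_dchars[OF assms(2)] c])
    then show "- log_series \<xi> ?z * (\<Prod>\<psi>\<in>dchars m - {\<xi>}. L_series \<psi> ?z) = - mangoldt_series \<xi> ?z * L_prod m ?z"
      using L_series_mangoldt_series[OF c assms(2), of ?z, symmetric] assms(3) by simp
  qed
  also have "\<dots> = - (\<Sum>\<xi>\<in>dchars m. cnj (\<xi> 1) * mangoldt_series \<xi> ?z) * L_prod m ?z"
  proof -
    have "mangoldt_series \<xi> ?z = cnj (\<xi> 1) * mangoldt_series \<xi> ?z" if "\<xi> \<in> dchars m" for \<xi>
      using dchars_1[OF that] by simp
    then have "(\<Sum>\<xi>\<in>dchars m. mangoldt_series \<xi> ?z) = (\<Sum>\<xi>\<in>dchars m. cnj (\<xi> 1) * mangoldt_series \<xi> ?z)"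
      by (intro sum.cong refl)
    then show ?thesis by (simp only: sum_distrib_right[symmetric] sum_negf)
  qed
  also have "(\<Sum>\<xi>\<in>dchars m. cnj (\<xi> 1) * mangoldt_series \<xi> ?z) = of_real (card (dchars m) * class_mangoldt m 1 s)"
    using assms by (intro sum_mangoldt_series) auto
  finally show ?thesis .
qed

text \<open>
  The product increases in absolute value as $s$ decreases to $1$, so it stays away from $0$.
\<close>
lemma cmod_L_prod_antimono:
  assumes "squarefree m" "m > 0" "1 < s" "s \<le> t"
  shows "cmod (L_prod m (of_real t)) \<le> cmod (L_prod m (of_real s))"
proof (rule cmod_exponential_growth(1)[OF _ assms(4)])
  fix x assume "s \<le> x"
  then have x: "1 < x" using assms by simp
  show "(L_prod m has_field_derivative
      - of_real (card (dchars m) * class_mangoldt m 1 x) * L_prod m (of_real x)) (at (of_real x))"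
    by (rule L_prod_derivative[OF assms(1,2) x])
  show "Re (- of_real (card (dchars m) * class_mangoldt m 1 x)) \<le> 0"
    using class_mangoldt_nonneg[OF x, of m 1] by simp
qed

text \<open>
  At $3$ the terms after the first one sum to at most $\frac12$ in absolute value.
\<close>
lemma L_series_3_nonzero:
  assumes c: "\<xi> \<in> dchars m" "m > 0"
  shows "L_series \<xi> 3 \<noteq> 0"
proof
  assume z: "L_series \<xi> 3 = 0"
  let ?f = "\<lambda>n. \<xi> n * of_nat n powr (- 3)"
  have sm: "summable (\<lambda>n. norm (?f n))" using summable_norm_L_series[OF c, of 3] by simp
  have "0 = (\<Sum>n. ?f (n + 2)) + (\<Sum>n<2. ?f n)"
    using suminf_split_initial_segment[OF summable_norm_cancel[OF sm], of 2] z by (simp add: L_series_def)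
  also have "(\<Sum>n<2. ?f n) = 1" using dchars_1[OF c(1)] by (simp add: numeral_2_eq_2)
  finally have "(\<Sum>n. ?f (n + 2)) = -1" by (simp add: eq_neg_iff_add_eq_0)
  then have "1 = norm (\<Sum>n. ?f (n + 2))" by simp
  also have "\<dots> \<le> (\<Sum>n. norm (?f (n + 2)))"
    using sm by (intro summable_norm) (subst summable_iff_shift)
  also have "\<dots> \<le> (\<Sum>n. (1/2) * (1 / real (n + 1) - 1 / real (Suc n + 1)))"
  proof (rule suminf_le)
    have "(\<lambda>n. 1 / real (n + 1)) \<longlonglongrightarrow> 0" by real_asymp
    from telescope_sums'[OF this] have t: "(\<lambda>n. 1 / real (n + 1) - 1 / real (Suc n + 1)) sums 1" by simp
    then show "summable (\<lambda>n. (1/2) * (1 / real (n + 1) - 1 / real (Suc n + 1)))"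
      by (intro summable_mult) (rule sums_summable)
    show "summable (\<lambda>n. norm (?f (n + 2)))" using sm by (subst summable_iff_shift)
    fix n
    have "norm (?f (n + 2)) \<le> 1 * real (n + 2) powr - 3"
      using cmod_dchars_le_1[OF c, of "n + 2"] norm_of_nat_powr[of "n + 2" 3]
      unfolding norm_mult by (intro mult_mono) auto
    also have "\<dots> = 1 / real (n + 2) ^ 3" by (simp add: powr_minus divide_simps flip: powr_numeral)
    also have "\<dots> \<le> (1/2) * (1 / real (n + 1) - 1 / real (Suc n + 1))"
    proof -
      have "2 * (real n + 1) * (real n + 2) \<le> (real n + 2) ^ 3"
        by (simp add: power3_eq_cube algebra_simps)
      then have "1 / (real n + 2) ^ 3 \<le> 1 / (2 * (real n + 1) * (real n + 2))"
        by (intro divide_left_mono) auto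
      also have "\<dots> = (1/2) * (1 / (real n + 1) - 1 / (real n + 2))" by (simp add: divide_simps)
      finally show ?thesis by (simp add: add.commute)
    qed
    finally show "norm (?f (n + 2)) \<le> (1/2) * (1 / real (n + 1) - 1 / real (Suc n + 1))" .
  qed
  also have "\<dots> = 1/2"
  proof -
    have "(\<lambda>n. 1 / real (n + 1)) \<longlonglongrightarrow> 0" by real_asymp
    from sums_mult[OF telescope_sums'[OF this], of "1/2"] show ?thesis by (simp add: sums_iff)
  qed
  finally show False by simp
qed

text \<open>
  A discrete form of $\int_k^{k+1} x^{-s}\,dx \ge (k+1)^{-s}$.
\<close>
lemma powr_telescope_bound:
  assumes "s > 1" "k \<ge> 1"
  shows "(s - 1) * real (k + 1) powr - s \<le> real k powr (1 - s) - real (k + 1) powr (1 - s)"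
proof -
  have "ln (real k / real (k + 1)) \<le> real k / real (k + 1) - 1"
    using assms by (intro ln_le_minus_one) auto
  also have "\<dots> = - (1 / real (k + 1))" by (simp add: field_simps)
  finally have "(1 - s) * - (1 / real (k + 1)) \<le> (1 - s) * ln (real k / real (k + 1))"
    using assms by (intro mult_left_mono_neg) auto
  then have "1 + (s - 1) / real (k + 1) \<le> 1 + (1 - s) * ln (real k / real (k + 1))" by (simp add: field_simps)
  also have "\<dots> \<le> exp ((1 - s) * ln (real k / real (k + 1)))" by (rule exp_ge_add_one_self)
  also have "\<dots> = (real k / real (k + 1)) powr (1 - s)" using assms by (simp add: powr_def)
  also have "\<dots> = real k powr (1 - s) / real (k + 1) powr (1 - s)" by (rule powr_divide)
  finally have "(1 + (s - 1) / real (k + 1)) * real (k + 1) powr (1 - s) \<le> real k powr (1 - s)"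
    by (subst (asm) pos_le_divide_eq) auto
  moreover have "real (k + 1) powr (1 - s) / real (k + 1) = real (k + 1) powr - s"
    by (simp add: powr_diff powr_minus divide_simps)
  moreover have "(1 + (s - 1) / real (k + 1)) * real (k + 1) powr (1 - s) =
      real (k + 1) powr (1 - s) + (s - 1) * (real (k + 1) powr (1 - s) / real (k + 1))"
    by (simp only: distrib_right mult_1 times_divide_eq_left times_divide_eq_right)
  ultimately show ?thesis by simp
qed

text \<open>
  The comparison with $\zeta(s) \le 1 + 1/(s - 1)$ holds for every character; it is applied to the
  principal one, to see that the pole at $1$ is at most simple.
\<close>
lemma L_series_principal_bound:
  assumes c: "\<xi> \<in> dchars m" "m > 0" and s: "1 < s" "s \<le> 2"
  shows "cmod (L_series \<xi> (of_real s)) \<le> 2 / (s - 1)"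
proof -
  let ?f = "\<lambda>n. \<xi> n * of_nat n powr (- of_real s)"
  have sm: "summable (\<lambda>n. norm (?f n))" using summable_norm_L_series[OF c, of "of_real s"] s by simp
  have "(\<lambda>n. real (n + 1) powr (1 - s)) \<longlonglongrightarrow> 0"
  proof (rule tendsto_neg_powr)
    show "filterlim (\<lambda>n. real (n + 1)) at_top sequentially" by real_asymp
  qed (use s in simp)
  from sums_mult[OF telescope_sums'[OF this], of "1 / (s - 1)"]
  have t: "(\<lambda>n. 1 / (s - 1) * (real (n + 1) powr (1 - s) - real (Suc n + 1) powr (1 - s))) sums (1 / (s - 1))"
    by simp
  have le1: "norm (?f n) \<le> real n powr - s" for n
    using mult_right_mono[OF cmod_dchars_le_1[OF c, of n], of "real n powr - s"] norm_of_nat_powr[of n "of_real s"]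
    by (simp add: norm_mult)
  have "(\<Sum>n. norm (?f (n + 2))) \<le> 1 / (s - 1)"
  proof (subst sums_unique[OF t], rule suminf_le)
    fix n
    have "norm (?f (n + 2)) \<le> real (n + 1 + 1) powr - s" using le1[of "n + 2"] by (simp add: add.commute)
    also have "\<dots> \<le> 1 / (s - 1) * (real (n + 1) powr (1 - s) - real (Suc n + 1) powr (1 - s))"
      using powr_telescope_bound[OF s(1), of "n + 1"] s by (simp add: field_simps)
    finally show "norm (?f (n + 2)) \<le> 1 / (s - 1) * (real (n + 1) powr (1 - s) - real (Suc n + 1) powr (1 - s))" .
  next
    show "summable (\<lambda>n. norm (?f (n + 2)))" using sm by (subst summable_iff_shift)
  qed (rule sums_summable[OF t])
  moreover have "(\<Sum>n<2. norm (?f n)) \<le> 1" using le1[of 1] by (simp add: numeral_2_eq_2)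
  moreover have "(\<Sum>n. norm (?f n)) = (\<Sum>n. norm (?f (n + 2))) + (\<Sum>n<2. norm (?f n))"
    by (rule suminf_split_initial_segment[OF sm])
  moreover have "cmod (L_series \<xi> (of_real s)) \<le> (\<Sum>n. norm (?f n))"
    unfolding L_series_def by (rule summable_norm[OF sm])
  moreover have "1 \<le> 1 / (s - 1)" using s by simp
  ultimately show ?thesis by simp
qed

text \<open>
  Two zeros at $1$ would outweigh the simple pole of the principal factor, and the product of all $L$-series
  would tend to $0$.
\<close>
lemma L_series_at_most_one_zero:
  assumes m: "squarefree m" "m > 0"
    and c1: "\<xi> \<in> dchars m" "\<xi> \<noteq> principal_dchar m" "L_series \<xi> 1 = 0"
    and c2: "\<psi> \<in> dchars m" "\<psi> \<noteq> principal_dchar m" "L_series \<psi> 1 = 0"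
  shows "\<xi> = \<psi>"
proof (rule ccontr)
  assume ne: "\<xi> \<noteq> \<psi>"
  let ?K = "2 * real m + 1" let ?p = "principal_dchar m"
  define R where "R = dchars m - {?p} - {\<xi>} - {\<psi>}"
  define C where "C = (\<Prod>\<eta>\<in>R. cmod (L_series \<eta> 1) + ?K)"
  define c where "c = cmod (L_prod m 3)"
  have C: "C \<ge> 0" unfolding C_def by (intro prod_nonneg) auto
  have fin: "finite (dchars m)" using finite_dchars m by blast
  have "c > 0" unfolding c_def L_prod_def using L_series_3_nonzero m fin by simp
  define D where "D = 2 * ?K * ?K * C"
  have D: "D \<ge> 0" using C by (simp add: D_def)
  have bound: "c \<le> D * (s - 1)" if s: "1 < s" "s \<le> 2" for s
  proof -
    let ?z = "complex_of_real s"
    have K: "cmod (L_series \<eta> ?z - L_series \<eta> 1) \<le> ?K * (s - 1)" if "\<eta> \<in> dchars m" "\<eta> \<noteq> ?p" for \<eta>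
      using L_series_lipschitz[OF that(1) m(2) that(2), of s] s by simp
    have split: "L_prod m ?z = L_series ?p ?z * (L_series \<xi> ?z * (L_series \<psi> ?z * (\<Prod>\<eta>\<in>R. L_series \<eta> ?z)))"
      unfolding L_prod_def R_def
      using fin principal_dchar_in_dchars[of m] c1 c2 ne
      by (subst prod.remove[of _ ?p], simp, simp, subst prod.remove[of _ \<xi>], simp, simp, 
         subst prod.remove[of _ \<psi>]) auto
    have "c \<le> cmod (L_prod m ?z)"
      unfolding c_def using cmod_L_prod_antimono[OF m s(1), of 3] s by simp
    also have "\<dots> = cmod (L_series ?p ?z) * (cmod (L_series \<xi> ?z) * (cmod (L_series \<psi> ?z) * (\<Prod>\<eta>\<in>R. cmod (L_series \<eta> ?z))))"
      unfolding split norm_mult prod_norm[symmetric] ..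
    also have "\<dots> \<le> (2 / (s - 1)) * ((?K * (s - 1)) * ((?K * (s - 1)) * C))"
    proof (intro mult_mono)
      show "cmod (L_series ?p ?z) \<le> 2 / (s - 1)"
        by (rule L_series_principal_bound[OF principal_dchar_in_dchars m(2) s])
      show "cmod (L_series \<xi> ?z) \<le> ?K * (s - 1)" using K[OF c1(1,2)] c1(3) by simp
      show "cmod (L_series \<psi> ?z) \<le> ?K * (s - 1)" using K[OF c2(1,2)] c2(3) by simp
      show "(\<Prod>\<eta>\<in>R. cmod (L_series \<eta> ?z)) \<le> C"
        unfolding C_def
      proof (intro prod_mono conjI)
        fix \<eta> assume "\<eta> \<in> R"
        then have "cmod (L_series \<eta> ?z - L_series \<eta> 1) \<le> ?K * (s - 1)" by (intro K) (auto simp: R_def)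
        also have "\<dots> \<le> ?K * 1" using s by (intro mult_left_mono) auto
        finally have "cmod (L_series \<eta> ?z - L_series \<eta> 1) \<le> ?K" by simp
        moreover have "cmod (L_series \<eta> ?z) \<le> cmod (L_series \<eta> 1) + cmod (L_series \<eta> ?z - L_series \<eta> 1)"
          by (rule norm_triangle_sub)
        ultimately show "cmod (L_series \<eta> ?z) \<le> cmod (L_series \<eta> 1) + ?K" by linarith
      qed auto
    qed (use s C in \<open>auto intro!: mult_nonneg_nonneg prod_nonneg\<close>)
    also have "\<dots> = D * (s - 1)" using s by (simp add: D_def field_simps)
    finally show ?thesis .
  qed
  \<comment> \<open>At distance \<open>h\<close> from 1 the upper bound \<open>D * h\<close> is smaller than the lower bound \<open>c\<close>.\<close>
  define h where "h = min 1 (c / (2 * (D + 1)))"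
  have h: "0 < h" "h \<le> 1" using \<open>c > 0\<close> D by (auto simp: h_def)
  have "c \<le> D * h" using bound[of "1 + h"] h by simp
  also have "\<dots> \<le> D * (c / (2 * (D + 1)))" using D by (intro mult_left_mono) (auto simp: h_def)
  also have "\<dots> < c" using \<open>c > 0\<close> D by (simp add: field_simps add_nonneg_pos)
  finally show False by simp
qed

section \<open>L-series of real characters do not vanish at 1\<close>

text \<open>
  Unique factorisation of the divisors of $p^k n$ when $p$ does not divide $n$.
\<close>
lemma divisors_prime_power_mult:
  fixes p n :: nat
  assumes "prime p" "\<not> p dvd n"
  shows "bij_betw (\<lambda>(i, d). p ^ i * d) ({..k} \<times> {d. d dvd n}) {d. d dvd p ^ k * n}"
  unfolding bij_betw_def
proof
  have le: "i = j \<and> d = e" if "p ^ i * d = p ^ j * e" "d dvd n" "e dvd n" "i \<le> j" for i j d e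
  proof -
    have p0: "p ^ i > 0" using assms(1) prime_gt_0_nat by simp
    have "p ^ i * d = p ^ i * (p ^ (j - i) * e)"
      using that(1,4) by (simp add: mult.assoc[symmetric] power_add[symmetric])
    then have d: "d = p ^ (j - i) * e" by (simp only: nat_mult_eq_cancel1[OF p0])
    have "j - i = 0"
    proof (rule ccontr)
      assume "j - i \<noteq> 0"
      then have "p dvd d" unfolding d by (simp add: dvd_power)
      with that(2) assms(2) show False by (meson dvd_trans)
    qed
    with d that(4) show ?thesis by simp
  qed
  show "inj_on (\<lambda>(i, d). p ^ i * d) ({..k} \<times> {d. d dvd n})"
  proof (rule inj_onI, clarify)
    fix i d j e assume "d dvd n" "e dvd n" and eq: "p ^ i * d = p ^ j * e"
    show "i = j \<and> d = e"
    proof (cases "i \<le> j")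
      case True
      show ?thesis by (rule le) fact+
    next
      case False
      then have "j = i \<and> e = d"
        using \<open>d dvd n\<close> \<open>e dvd n\<close> eq by (intro le) auto
      then show ?thesis by simp
    qed
  qed
  show "(\<lambda>(i, d). p ^ i * d) ` ({..k} \<times> {d. d dvd n}) = {d. d dvd p ^ k * n}"
  proof (intro subset_antisym subsetI)
    fix e assume "e \<in> {d. d dvd p ^ k * n}"
    then obtain x y where xy: "e = x * y" "x dvd p ^ k" "y dvd n"
      using division_decomp[of e "p ^ k" n] by auto
    then obtain i where "x = p ^ i" "i \<le> k" using divides_primepow_nat[OF assms(1)] by blast
    with xy show "e \<in> (\<lambda>(i, d). p ^ i * d) ` ({..k} \<times> {d. d dvd n})" by auto
  next
    fix e assume "e \<in> (\<lambda>(i, d). p ^ i * d) ` ({..k} \<times> {d. d dvd n})"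
    then show "e \<in> {d. d dvd p ^ k * n}" by (auto intro!: mult_dvd_mono le_imp_power_dvd)
  qed
qed

text \<open>
  For $t = -1$ the sum alternates between $1$ and $0$; at $t = 0$ it is $1$ because $0^0 = 1$.
\<close>
lemma geometric_sum_sign:
  fixes t :: real
  assumes "t \<in> {-1, 0, 1}"
  shows "(\<Sum>i\<le>k. t ^ i) \<ge> of_bool (even k)"
proof -
  consider "t = -1" | "t = 0" | "t = 1" using assms by auto
  then show ?thesis
  proof cases
    case 1
    have "(\<Sum>i\<le>k. (-1) ^ i) = (of_bool (even k) :: real)" by (induction k) auto
    with 1 show ?thesis by simp
  next
    case 2
    have "(\<Sum>i\<le>k. 0 ^ i) = (1 :: real)" by (induction k) auto
    with 2 show ?thesis by simp
  qed (simp add: of_bool_def)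
qed

text \<open>
  The divisor sum is multiplicative, and on a prime power it is a geometric sum, which is
  nonnegative, and at least $1$ for even exponents.
\<close>
lemma divisor_sum_nonneg:
  fixes \<rho> :: "nat \<Rightarrow> real"
  assumes mult: "\<And>a b. \<rho> (a * b) = \<rho> a * \<rho> b" and one: "\<rho> 1 = 1" and val: "\<And>a. \<rho> a \<in> {-1, 0, 1}"
    and "n > 0"
  shows "(\<Sum>d | d dvd n. \<rho> d) \<ge> 0 \<and> (\<Sum>d | d dvd n ^ 2. \<rho> d) \<ge> 1"
  using \<open>n > 0\<close>
proof (induction n rule: less_induct)
  case (less n)
  show ?case
  proof (cases "n = 1")
    case True
    then show ?thesis using one by simp
  next
    case False
    then obtain p where p: "prime p" "p dvd n" using prime_factor_nat by blast
    define k where "k = multiplicity p n"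
    obtain n' where n': "n = p ^ k * n'" "\<not> p dvd n'"
      using multiplicity_decompose'[of n p] less.prems p(1) unfolding k_def
      by (metis not_prime_unit less_irrefl)
    have "k > 0" using p less.prems by (simp add: k_def prime_multiplicity_gt_zero_iff)
    have "n' > 0" using n' less.prems by (auto intro: Nat.gr0I)
    have "p ^ k > 1" using prime_gt_1_nat[OF p(1)] \<open>k > 0\<close> by (rule one_less_power)
    then have "n' < n" using n'(1) \<open>n' > 0\<close> by simp
    have pow: "\<rho> (p ^ i) = \<rho> p ^ i" for i
      using one by (induction i) (simp_all add: mult)
    have split: "(\<Sum>d | d dvd p ^ j * l. \<rho> d) = (\<Sum>i\<le>j. \<rho> p ^ i) * (\<Sum>d | d dvd l. \<rho> d)"
      if "\<not> p dvd l" for j l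
    proof -
      have "(\<Sum>d | d dvd p ^ j * l. \<rho> d) = (\<Sum>x\<in>{..j} \<times> {d. d dvd l}. \<rho> (case x of (i, d) \<Rightarrow> p ^ i * d))"
        by (rule sum.reindex_bij_betw[OF divisors_prime_power_mult[OF p(1) that], symmetric])
      also have "\<dots> = (\<Sum>(i, d)\<in>{..j} \<times> {d. d dvd l}. \<rho> p ^ i * \<rho> d)"
        by (intro sum.cong refl) (auto simp: mult pow)
      also have "\<dots> = (\<Sum>i\<le>j. \<rho> p ^ i) * (\<Sum>d | d dvd l. \<rho> d)"
        by (simp add: sum_product sum.cartesian_product)
      finally show ?thesis .
    qed
    have IH: "(\<Sum>d | d dvd n'. \<rho> d) \<ge> 0" "(\<Sum>d | d dvd n' ^ 2. \<rho> d) \<ge> 1"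
      using less.IH[OF \<open>n' < n\<close> \<open>n' > 0\<close>] by auto
    have "(\<Sum>i\<le>k. \<rho> p ^ i) \<ge> 0"
      using geometric_sum_sign[OF val[of p], of k] by (rule order_trans[rotated]) simp
    then have "(\<Sum>d | d dvd n. \<rho> d) \<ge> 0"
      unfolding n'(1) split[OF n'(2)] using IH(1) by simp
    moreover have "(\<Sum>d | d dvd n ^ 2. \<rho> d) \<ge> 1"
    proof -
      have nd: "\<not> p dvd n' ^ 2" using n'(2) p(1) by (simp add: prime_dvd_power_iff)
      have "n ^ 2 = p ^ (2 * k) * n' ^ 2"
        by (simp add: n'(1) power_mult_distrib power_mult[symmetric] mult.commute)
      then have eq: "(\<Sum>d | d dvd n ^ 2. \<rho> d) = (\<Sum>i\<le>2 * k. \<rho> p ^ i) * (\<Sum>d | d dvd n' ^ 2. \<rho> d)"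
        by (simp only: split[OF nd])
      have "(\<Sum>i\<le>2 * k. \<rho> p ^ i) \<ge> 1" using geometric_sum_sign[OF val[of p], of "2 * k"] by simp
      then have "1 * 1 \<le> (\<Sum>i\<le>2 * k. \<rho> p ^ i) * (\<Sum>d | d dvd n' ^ 2. \<rho> d)"
        using IH(2) by (intro mult_mono) auto
      with eq show ?thesis by simp
    qed
    ultimately show ?thesis ..
  qed
qed

text \<open>
  The arithmetic-geometric inequality, applied to the terms $i$ and $n - 1 - i$ of the sum.
\<close>
lemma sum_even_powers_ge:
  fixes y :: real
  assumes "n \<ge> 1"
  shows "real n * y ^ (n - 1) \<le> (\<Sum>i<n. y ^ (2 * i))"
proof -
  have "2 * (real n * y ^ (n - 1)) = (\<Sum>i<n. 2 * (y ^ i * y ^ (n - Suc i)))"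
    by (simp add: power_add[symmetric])
  also have "\<dots> \<le> (\<Sum>i<n. y ^ (2 * i) + y ^ (2 * (n - Suc i)))"
  proof (intro sum_mono)
    fix i
    show "2 * (y ^ i * y ^ (n - Suc i)) \<le> y ^ (2 * i) + y ^ (2 * (n - Suc i))"
      using sum_squares_bound[of "y ^ i" "y ^ (n - Suc i)"] by (simp only: power_even_eq mult.assoc)
  qed
  also have "\<dots> = 2 * (\<Sum>i<n. y ^ (2 * i))"
    using sum.nat_diff_reindex[of "\<lambda>i. y ^ (2 * i)" n] by (simp add: sum.distrib)
  finally show ?thesis by simp
qed

text \<open>
  If $\sum \xi(n)/n = 0$, subtracting the multiple $1/(n(1-x))$ does not change the sum of the Lambert
  series, up to sign.  The difference is small: unlike the terms $x^n / (1 - x^n)$ it stays bounded as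
  $x \to 1$.
\<close>
definition lambert_defect :: "real \<Rightarrow> nat \<Rightarrow> real" where
  "lambert_defect x n = 1 / (real n * (1 - x)) - x ^ n / (1 - x ^ n)"

lemma lambert_defect:
  assumes x: "0 < x" "x < 1" and n: "n \<ge> 1"
  shows "lambert_defect x n \<ge> 0" "lambert_defect x (Suc n) \<le> lambert_defect x n"
proof -
  define y where "y = sqrt x"
  have y: "0 < y" "y < 1" "x = y ^ 2" using x by (auto simp: y_def)
  define S where "S k = (\<Sum>i<k. y ^ (2 * i))" for k
  have S: "1 - x ^ k = (1 - x) * S k" for k
    using one_diff_power_eq[of x k] by (simp add: S_def y(3) power_mult)
  have Sge: "real k * y ^ (k - 1) \<le> S k" if "k \<ge> 1" for k
    using sum_even_powers_ge[OF that] by (simp add: S_def)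
  have Spos: "S k > 0" if "k \<ge> 1" for k
    using Sge[OF that] y that by (intro less_le_trans[OF _ Sge[OF that]]) simp
  have x1: "1 - x > 0" using x by simp
  have xn: "x ^ k = y ^ (2 * k)" for k by (simp add: y(3) power_mult)
  have 1: "real n * x ^ n \<le> S n"
  proof -
    have "y ^ (2 * n) \<le> y ^ (n - 1)" using y by (intro power_decreasing) auto
    then have "real n * x ^ n \<le> real n * y ^ (n - 1)" unfolding xn by (intro mult_left_mono) auto
    with Sge[OF n] show ?thesis by simp
  qed
  have "x ^ n / (1 - x ^ n) \<le> 1 / (real n * (1 - x))"
    unfolding S using 1 n x1 Spos[OF n] by (simp add: divide_simps mult_ac)
  then show "lambert_defect x n \<ge> 0" by (simp add: lambert_defect_def)
  have "real n * (real n + 1) * x ^ n \<le> S n * S (Suc n)"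
  proof -
    have "y ^ (2 * n) \<le> y ^ (n - 1) * y ^ n"
      using y unfolding power_add[symmetric] by (intro power_decreasing) auto
    then have "real n * (real n + 1) * x ^ n \<le> real n * (real n + 1) * (y ^ (n - 1) * y ^ n)"
      unfolding xn by (intro mult_left_mono) auto
    also have "\<dots> = (real n * y ^ (n - 1)) * (real (Suc n) * y ^ (Suc n - 1))" by (simp add: mult_ac)
    also have "\<dots> \<le> S n * S (Suc n)"
      using y Sge[OF n] Sge[of "Suc n"] Spos[OF n] by (intro mult_mono) auto
    finally show ?thesis .
  qed
  then have 2: "x ^ n / (S n * S (Suc n)) \<le> 1 / (real n * (real n + 1))"
    using n Spos[OF n] Spos[of "Suc n"] by (simp add: divide_simps mult_ac)
  have "x ^ n / (1 - x ^ n) - x ^ Suc n / (1 - x ^ Suc n) = x ^ n * (1 - x) / ((1 - x ^ n) * (1 - x ^ Suc n))"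
  proof -
    have "1 - x ^ n \<noteq> 0" "1 - x ^ Suc n \<noteq> 0" using x1 Spos[OF n] Spos[of "Suc n"] unfolding S by auto
    then show ?thesis by (simp add: divide_simps) (simp add: algebra_simps)
  qed
  also have "\<dots> = (x ^ n / (S n * S (Suc n))) / (1 - x)"
    unfolding S using x1 by (simp add: divide_simps)
  also have "\<dots> \<le> (1 / (real n * (real n + 1))) / (1 - x)"
    using 2 x1 by (intro divide_right_mono) auto
  also have "\<dots> = 1 / (real n * (1 - x)) - 1 / (real (Suc n) * (1 - x))"
    using n x1 by (simp add: divide_simps)
  finally show "lambert_defect x (Suc n) \<le> lambert_defect x n"
    by (simp add: lambert_defect_def)
qed

text \<open>
  Monsky's argument.  If $L(1) = 0$, the Lambert series equals $-\sum \xi(n)\, b_n$ where $b_n$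
  is \<open>lambert_defect\<close>; as $b_n$ decreases from $b_1 = 1$, summation by parts bounds it by $2m$, uniformly in $x < 1$.
  Its power series has the divisor sums of $\xi$ as coefficients, which are nonnegative and at least $1$ at squares,
  so it exceeds $2m$ as $x \to 1$.
\<close>
lemma L_series_real_nonzero:
  assumes c: "\<xi> \<in> dchars m" "m > 0" "\<xi> \<noteq> principal_dchar m" and re: "\<And>a. cnj (\<xi> a) = \<xi> a"
  shows "L_series \<xi> 1 \<noteq> 0"
proof
  assume zero: "L_series \<xi> 1 = 0"
  define \<rho> where "\<rho> a = Re (\<xi> a)" for a
  have \<xi>: "\<xi> a = of_real (\<rho> a)" for a
    unfolding \<rho>_def using re[of a] by (simp add: complex_eq_iff)
  have mult: "\<rho> (a * b) = \<rho> a * \<rho> b" for a b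
    using dchars_mult[OF c(1), of a b] unfolding \<xi> by (simp flip: of_real_mult)
  have one: "\<rho> 1 = 1" using dchars_1[OF c(1)] unfolding \<xi> by simp
  have val: "\<rho> a \<in> {-1, 0, 1}" for a
  proof -
    have "cmod (\<xi> a) = of_bool (coprime a m)" by (rule cmod_dchars[OF c(1,2)])
    then have "\<bar>\<rho> a\<bar> = of_bool (coprime a m)" unfolding \<xi> by simp
    then show ?thesis by (cases "coprime a m") auto
  qed
  have bound: "(\<Sum>j=1..K. x ^ (j ^ 2)) \<le> 2 * real m" if x: "0 < x" "x < 1" for x K
  proof -
    define R where "R d = \<xi> d * of_real (x ^ d / (1 - x ^ d))" for d
    define F where "F = (\<lambda>(d, k). \<xi> d * of_real (x ^ (d * k)))"
    have geo: "((\<lambda>k. x ^ (d * k)) has_sum x ^ d / (1 - x ^ d)) {1..}" if "d \<ge> 1" for d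
    proof -
      have "x ^ d < 1" using x that by (intro power_less_one_iff[THEN iffD2]) auto
      then show ?thesis
        using has_sum_geometric_from_1[of "x ^ d"] x by (simp add: power_mult)
    qed
    have row: "((\<lambda>k. norm (F (d, k))) has_sum cmod (\<xi> d) * (x ^ d / (1 - x ^ d))) {1..}" if "d \<ge> 1" for d
      using has_sum_cmult_right[OF geo[OF that], of "cmod (\<xi> d)"] x by (simp add: F_def norm_mult norm_power)
    have "(\<lambda>y. norm (F y)) summable_on {1..} \<times> {1..}"
      unfolding Infinite_Sum.abs_summable_on_Sigma_iff
    proof (intro conjI ballI)
      show "(\<lambda>k. norm (F (d, k))) summable_on {1..}" if "d \<in> {1..}" for d
        using row[of d] that by (auto intro: has_sum_imp_summable)
      have "(\<lambda>d. x ^ d / (1 - x)) summable_on {1..}"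
        unfolding divide_inverse using has_sum_geometric_from_1[of x] x
        by (intro summable_on_cmult_left) (auto intro: has_sum_imp_summable)
      then show "(\<lambda>d. norm (\<Sum>\<^sub>\<infinity>k\<in>{1..}. norm (F (d, k)))) summable_on {1..}"
      proof (rule Infinite_Sum.abs_summable_on_comparison_test')
        fix d :: nat assume d: "d \<in> {1..}"
        then have xd: "x ^ d \<le> x" using x power_decreasing[of 1 d x] by simp
        have "(\<Sum>\<^sub>\<infinity>k\<in>{1..}. norm (F (d, k))) = cmod (\<xi> d) * (x ^ d / (1 - x ^ d))"
          using d by (intro infsumI row) simp
        also have "\<dots> \<le> 1 * (x ^ d / (1 - x))"
          using cmod_dchars_le_1[OF c(1,2)] x xd by (intro mult_mono divide_left_mono) auto
        finally show "norm (\<Sum>\<^sub>\<infinity>k\<in>{1..}. norm (F (d, k))) \<le> x ^ d / (1 - x)"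
          by (simp add: infsum_nonneg)
      qed
    qed
    then have "F summable_on {1..} \<times> {1..}" by (rule abs_summable_summable)
    moreover have "((\<lambda>k. F (d, k)) has_sum R d) {1..}" if "d \<ge> 1" for d
      unfolding F_def R_def prod.case
      by (intro has_sum_cmult_right has_sum_of_real geo that)
    ultimately obtain S where S: "(R has_sum S) {1..}"
        "((\<lambda>n. \<Sum>d | d dvd n. F (d, n div d)) has_sum S) {1..}"
      by (rule has_sum_divisors)

    have "(\<lambda>n. \<xi> n * of_nat n powr (- 1)) sums 0"
      using summable_sums[OF summable_L_series_nonprincipal[OF c, of 1]] zero by (simp add: L_series_def)
    from sums_mult2[OF this, of "1 / of_real (1 - x)"]
    have "(\<lambda>n. \<xi> n * of_real (1 / (real n * (1 - x)))) sums 0"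
      by (simp add: powr_minus divide_simps)
    moreover have "R sums S" by (rule sums_from_1[OF S(1)]) (simp add: R_def)
    ultimately have "(\<lambda>n. \<xi> n * of_real (1 / (real n * (1 - x))) - R n) sums (0 - S)" by (rule sums_diff)
    then have "(\<lambda>n. \<xi> n * of_real (lambert_defect x n)) sums (- S)"
      by (simp add: R_def lambert_defect_def algebra_simps)
    then have lim: "(\<lambda>M. cmod (\<Sum>n<M. \<xi> n * of_real (lambert_defect x n))) \<longlonglongrightarrow> cmod (- S)"
      unfolding sums_def by (rule tendsto_norm)
    have part: "cmod (\<Sum>n<M. \<xi> n * of_real (lambert_defect x n)) \<le> 2 * real m" for M
    proof (cases "M = 0")
      case False
      have "(\<Sum>n<M. \<xi> n * of_real (lambert_defect x n)) = (\<Sum>n=1..<M. \<xi> n * of_real (lambert_defect x n))"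
        by (intro sum.mono_neutral_right) (auto simp: lambert_defect_def Suc_le_eq)
      also have "cmod \<dots> \<le> 2 * real m * lambert_defect x 1"
        using False lambert_defect[OF x]
        by (intro abel_summation_bound cmod_dchars_partial_sum_le c) auto
      also have "lambert_defect x 1 = 1" using x by (simp add: lambert_defect_def divide_simps)
      finally show ?thesis by simp
    qed simp
    have "cmod (- S) \<le> 2 * real m"
      by (rule LIMSEQ_le_const2[OF lim]) (use part in blast)
    then have "Re S \<le> 2 * real m" using complex_Re_le_cmod[of S] by simp

    define cn where "cn n = (\<Sum>d | d dvd n. \<rho> d) * x ^ n" for n
    have "Re (\<Sum>d | d dvd n. F (d, n div d)) = cn n" for n
    proof -
      have "(\<Sum>d | d dvd n. F (d, n div d)) = (\<Sum>d | d dvd n. of_real (\<rho> d * x ^ n))"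
        by (intro sum.cong refl) (auto simp: F_def \<xi>)
      then show ?thesis by (simp add: cn_def sum_distrib_right)
    qed
    with has_sum_Re[OF S(2)] have cs: "(cn has_sum Re S) {1..}" by simp
    have "(\<Sum>j=1..K. x ^ (j ^ 2)) \<le> (\<Sum>j=1..K. cn (j ^ 2))"
    proof (rule sum_mono)
      fix j assume "j \<in> {1..K}"
      then have "1 * x ^ (j ^ 2) \<le> cn (j ^ 2)"
        unfolding cn_def using x divisor_sum_nonneg[OF mult one val, of j] by (intro mult_right_mono) auto
      then show "x ^ (j ^ 2) \<le> cn (j ^ 2)" by simp
    qed
    also have "\<dots> = (\<Sum>n\<in>(\<lambda>j. j ^ 2) ` {1..K}. cn n)"
      by (subst sum.reindex) (auto simp: inj_on_def)
    also have "\<dots> \<le> Re S"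
    proof (rule finite_sum_le_has_sum[OF cs])
      fix n assume "n \<in> {1..} - (\<lambda>j. j ^ 2) ` {1..K}"
      then show "0 \<le> cn n"
        unfolding cn_def using x divisor_sum_nonneg[OF mult one val, of n] by (intro mult_nonneg_nonneg) auto
    qed auto
    finally show ?thesis using \<open>Re S \<le> 2 * real m\<close> by simp
  qed
  have "((\<lambda>x. \<Sum>j=1..2 * m + 1. x ^ (j ^ 2)) \<longlongrightarrow> (\<Sum>j=1..2 * m + 1. 1 ^ (j ^ 2))) (at_left (1::real))"
    by (intro tendsto_intros)
  moreover have "\<forall>\<^sub>F x in at_left (1::real). x \<in> {0<..<1}"
    by (rule eventually_at_left_real) simp
  then have "\<forall>\<^sub>F x in at_left (1::real). (\<Sum>j=1..2 * m + 1. x ^ (j ^ 2)) \<le> 2 * real m"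
  proof eventually_elim
    case (elim x)
    then have "0 < x" "x < 1" by auto
    then show ?case by (rule bound)
  qed
  ultimately have "(\<Sum>j=1..2 * m + 1. 1 ^ (j ^ 2)) \<le> 2 * real m"
    by (intro tendsto_upperbound) auto
  then show False by simp
qed

section \<open>Dirichlet's theorem for squarefree moduli\<close>

text \<open>
  A zero of $L(s, \xi)$ at $1$ is also a zero for the conjugate character, so $\xi$ would be real.
\<close>
lemma L_series_nonprincipal_nonzero:
  assumes m: "squarefree m" "m > 0" and c: "\<xi> \<in> dchars m" "\<xi> \<noteq> principal_dchar m"
  shows "L_series \<xi> 1 \<noteq> 0"
proof
  assume zero: "L_series \<xi> 1 = 0"
  define \<psi> where "\<psi> = (\<lambda>a. cnj (\<xi> a))"
  have \<psi>: "\<psi> \<in> dchars m" unfolding \<psi>_def by (rule cnj_in_dchars[OF c(1)])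
  have np: "\<psi> \<noteq> principal_dchar m"
  proof
    assume "\<psi> = principal_dchar m"
    then have "cnj (\<xi> a) = principal_dchar m a" for a by (metis \<psi>_def)
    then have "\<xi> a = cnj (principal_dchar m a)" for a by (metis complex_cnj_cnj)
    then have "\<xi> = principal_dchar m" by (auto simp: principal_dchar_def)
    with c(2) show False ..
  qed
  have "(\<lambda>n. \<xi> n * of_nat n powr (- 1)) sums L_series \<xi> 1"
    unfolding L_series_def using summable_L_series_nonprincipal[OF c(1) m(2) c(2), of 1]
    by (intro summable_sums) simp
  then have "(\<lambda>n. cnj (\<xi> n * of_nat n powr (- 1))) sums cnj (L_series \<xi> 1)"
    by (simp only: sums_cnj)
  moreover have "(\<lambda>n. cnj (\<xi> n * of_nat n powr (- 1))) = (\<lambda>n. \<psi> n * of_nat n powr (- 1))"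
    by (simp add: \<psi>_def powr_minus)
  ultimately have "(\<lambda>n. \<psi> n * of_nat n powr (- 1)) sums cnj (L_series \<xi> 1)"
    by simp
  then have "L_series \<psi> 1 = cnj (L_series \<xi> 1)"
    unfolding L_series_def[of \<psi>] by (rule sums_unique[symmetric])
  then have "L_series \<psi> 1 = 0" by (simp add: zero)
  with L_series_at_most_one_zero[OF m c zero \<psi> np] have "\<xi> = \<psi>" by simp
  then have "cnj (\<xi> a) = \<xi> a" for a by (metis \<psi>_def)
  with L_series_real_nonzero[OF c(1) m(2) c(2)] zero show False by blast
qed

lemma log_series_bound:
  assumes c: "\<xi> \<in> dchars m" "m > 0" "\<xi> \<noteq> principal_dchar m" and s: "s > 1"
  shows "cmod (log_series \<xi> (of_real s)) \<le> 2 * real m + 1"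
proof -
  let ?f = "\<lambda>n. \<xi> n * of_real (ln (real n)) * of_nat n powr (- of_real s)"
  have "summable (\<lambda>n. norm (?f n))"
  proof (rule summable_comparison_test')
    show "summable (\<lambda>n. ln (real n) * real n powr - s)" using s by (rule summable_ln_powr)
    fix n :: nat assume "n \<ge> 1"
    then show "norm (norm (?f n)) \<le> ln (real n) * real n powr - s"
      using mult_right_mono[OF cmod_dchars_le_1[OF c(1,2), of n], of "ln (real n) * real n powr - s"]
        norm_of_nat_powr[of n "of_real s"]
      by (simp add: norm_mult mult.assoc)
  qed
  then have "(\<lambda>M. \<Sum>n<M. ?f n) \<longlonglongrightarrow> log_series \<xi> (of_real s)"
    unfolding log_series_def by (intro summable_LIMSEQ) (rule summable_norm_cancel)
  then have "(\<lambda>M. cmod (\<Sum>n<M. ?f n)) \<longlonglongrightarrow> cmod (log_series \<xi> (of_real s))" by (rule tendsto_norm)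
  then show ?thesis
    by (rule LIMSEQ_le_const2) (use log_series_partial_bound[OF c] s in \<open>intro exI allI impI, simp\<close>)
qed

text \<open>
  The quotient of the bounded series $L \cdot H$ by $L$, which stays away from $0$ near $1$.
\<close>
lemma mangoldt_series_bounded:
  assumes m: "squarefree m" "m > 0" and c: "\<xi> \<in> dchars m" "\<xi> \<noteq> principal_dchar m"
  shows "\<exists>B. \<forall>\<^sub>F s in at_right 1. cmod (mangoldt_series \<xi> (of_real s)) \<le> B"
proof -
  let ?K = "2 * real m + 1"
  define l where "l = cmod (L_series \<xi> 1)"
  have l: "l > 0" using L_series_nonprincipal_nonzero[OF assms] by (simp add: l_def)
  have "\<forall>\<^sub>F s in at_right 1. s \<in> {1<..<1 + l / (2 * ?K)}"
    using l by (intro eventually_at_right_real) (simp add: add_pos_nonneg)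
  then have "\<forall>\<^sub>F s in at_right 1. cmod (mangoldt_series \<xi> (of_real s)) \<le> 2 * ?K / l"
  proof eventually_elim
    case (elim s)
    then have s: "1 < s" "s - 1 < l / (2 * ?K)" by auto
    let ?z = "complex_of_real s"
    have "cmod (L_series \<xi> ?z - L_series \<xi> 1) \<le> ?K * (s - 1)"
      using s by (intro L_series_lipschitz c m) auto
    also have "\<dots> \<le> ?K * (l / (2 * ?K))" using s by (intro mult_left_mono) auto
    also have "\<dots> = l / 2" by (simp add: field_simps add_pos_nonneg)
    finally have "cmod (L_series \<xi> ?z) \<ge> l / 2"
      using norm_triangle_ineq3[of "L_series \<xi> ?z" "L_series \<xi> 1"] unfolding l_def by linarith
    then have "(l / 2) * cmod (mangoldt_series \<xi> ?z) \<le> cmod (L_series \<xi> ?z) * cmod (mangoldt_series \<xi> ?z)"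
      by (intro mult_right_mono) auto
    also have "\<dots> = cmod (log_series \<xi> ?z)"
      using L_series_mangoldt_series[OF c(1) m(2), of ?z] s by (simp flip: norm_mult)
    also have "\<dots> \<le> ?K" using s by (intro log_series_bound c m)
    finally show ?case using l by (simp add: field_simps)
  qed
  then show ?thesis by blast
qed

text \<open>
  Prime powers $p^{j+2}$ contribute a geometric sum of size $\log(p)/p^2$ up to a constant factor, so only the primes
  themselves can make \<open>class_mangoldt\<close> unbounded.
\<close>
lemma summable_on_higher_prime_powers:
  "summable (\<lambda>n. of_bool (\<not> prime n) * mangoldt n / real n)"
proof -
  let ?g = "\<lambda>n. of_bool (\<not> prime n) * mangoldt n / real n :: real"
  let ?A = "{p::nat. prime p} \<times> (UNIV :: nat set)"
  let ?h = "\<lambda>(p::nat, j::nat). p ^ (j + 2)"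
  have g0: "?g n \<ge> 0" for n by (simp add: mangoldt_nonneg)
  have row: "((\<lambda>j. ?g (?h (p, j))) has_sum ln (real p) * (1 / real p ^ 2) * (1 / (1 - 1 / real p))) UNIV"
    if "prime p" for p
  proof -
    have p: "real p > 1" using prime_gt_1_nat[OF that] by simp
    have s: "(\<lambda>j. ln (real p) * (1 / real p ^ 2) * (1 / real p) ^ j) sums
        (ln (real p) * (1 / real p ^ 2) * (1 / (1 - 1 / real p)))"
      using p by (intro sums_mult geometric_sums) auto
    have e: "?g (?h (p, j)) = ln (real p) * (1 / real p ^ 2) * (1 / real p) ^ j" for j
    proof -
      have "\<not> prime (p ^ (j + 2))" unfolding prime_power_iff by simp
      moreover have "mangoldt (p ^ (j + 2)) = ln (real p)" using that by (subst mangoldt_primepow') auto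
      ultimately show ?thesis by (simp add: power_add power_divide power2_eq_square field_simps)
    qed
    show ?thesis
      unfolding e by (rule sums_nonneg_imp_has_sum[OF s]) (use p in \<open>auto intro!: mult_nonneg_nonneg\<close>)
  qed
  have "(\<lambda>x. ?g (?h x)) summable_on ?A"
  proof (rule summable_on_SigmaI)
    show "((\<lambda>j. ?g (?h (p, j))) has_sum ln (real p) * (1 / real p ^ 2) * (1 / (1 - 1 / real p))) UNIV"
      if "p \<in> {p. prime p}" for p using row that by blast
    show "(\<lambda>p. ln (real p) * (1 / real p ^ 2) * (1 / (1 - 1 / real p))) summable_on {p. prime p}"
    proof (rule summable_on_comparison_test)
      have "0 \<le> ln (real p) * real p powr - 2" for p :: nat
        by (cases "p = 0") auto
      moreover have "summable (\<lambda>p. 2 * (ln (real p) * real p powr - 2))"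
        by (intro summable_mult summable_ln_powr) simp
      ultimately have "(\<lambda>p. 2 * (ln (real p) * real p powr - 2)) summable_on UNIV"
        by (subst summable_on_UNIV_nonneg_real_iff) auto
      then show "(\<lambda>p. 2 * (ln (real p) * real p powr - 2)) summable_on {p. prime p}"
        by (rule summable_on_subset_banach) simp
      fix p :: nat assume "p \<in> {p. prime p}"
      then have p: "real p \<ge> 2" using prime_ge_2_nat[of p] by simp
      then have "1 / (1 - 1 / real p) \<le> 2" by (simp add: field_simps)
      then have "ln (real p) * (1 / real p ^ 2) * (1 / (1 - 1 / real p)) \<le> ln (real p) * (1 / real p ^ 2) * 2"
        using p by (intro mult_left_mono) auto
      also have "\<dots> = 2 * (ln (real p) * real p powr - 2)"
        using p by (simp add: powr_minus divide_simps)
      finally show "ln (real p) * (1 / real p ^ 2) * (1 / (1 - 1 / real p)) \<le> 2 * (ln (real p) * real p powr - 2)" .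
      show "0 \<le> ln (real p) * (1 / real p ^ 2) * (1 / (1 - 1 / real p))"
        using p by (intro mult_nonneg_nonneg) auto
    qed
  qed (rule g0)
  moreover have "inj_on ?h ?A"
  proof (rule inj_onI, clarify)
    fix p j q k :: nat assume pq: "prime p" "prime q" and eq: "p ^ (j + 2) = q ^ (k + 2)"
    from eq have "j + 2 = 0 \<and> k + 2 = 0 \<or> p = q \<and> j + 2 = k + 2"
      by (rule prime_power_inj''[OF pq, THEN iffD1])
    then show "p = q \<and> j = k" by simp
  qed
  ultimately have "?g summable_on ?h ` ?A"
    by (subst summable_on_reindex) (auto simp: o_def)
  moreover have g_neutral: "?g n = 0" if "n \<notin> ?h ` ?A" for n
  proof (cases "primepow n \<and> \<not> prime n")
    case True
    then obtain p k where pk: "prime p" "k > 0" "n = p ^ k" by (auto simp: primepow_def)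
    with True have "k \<noteq> 1" by auto
    with pk(2) have "k - 2 + 2 = k" by simp
    with pk(3) have "n = ?h (p, k - 2)" by (simp only: prod.case)
    with pk(1) that show ?thesis by blast
  qed (auto simp: mangoldt_def)
  moreover have "?g summable_on UNIV \<longleftrightarrow> ?g summable_on ?h ` ?A"
    by (rule summable_on_cong_neutral) (use g_neutral in blast)+
  ultimately have "?g summable_on UNIV" by blast
  then show ?thesis by (rule summable_on_imp_summable)
qed

lemma class_mangoldt_bounded:
  assumes fin: "finite {r. prime r \<and> [r = a] (mod m)}"
  shows "\<exists>B. \<forall>s>1. class_mangoldt m a s \<le> B"
proof -
  define Q where "Q = {r. prime r \<and> [r = a] (mod m)}"
  have Q: "finite Q" using fin by (simp add: Q_def)
  let ?b = "\<lambda>n. of_bool (n \<in> Q) * mangoldt n + of_bool (\<not> prime n) * mangoldt n / real n :: real"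
  have sb: "summable ?b"
    using Q by (intro summable_add summable_on_higher_prime_powers summable_finite[of Q]) auto
  have "class_mangoldt m a s \<le> suminf ?b" if s: "s > 1" for s
    unfolding class_mangoldt_def
  proof (rule suminf_le[OF _ summable_class_mangoldt[OF s] sb])
    fix n
    show "of_bool ([n = a] (mod m)) * mangoldt n * real n powr - s \<le> ?b n"
    proof (cases "n = 0")
      case False
      have "real n powr - s \<le> real n powr - 1" using s False by (intro powr_mono) auto
      then have le: "real n powr - s \<le> 1 / real n" using False by (simp add: powr_minus divide_simps)
      moreover have "1 / real n \<le> 1" using False by simp
      ultimately have "mangoldt n * real n powr - s \<le> mangoldt n * (1 / real n)"
        "mangoldt n * real n powr - s \<le> mangoldt n * 1"
        by (intro mult_left_mono mangoldt_nonneg; linarith)+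
      then show ?thesis
        using mangoldt_nonneg[of n] by (auto simp: Q_def of_bool_def)
    qed simp
  qed
  then show ?thesis by blast
qed

text \<open>
  The terms with $n \equiv 1 \pmod m$ alone form a divergent harmonic series at $s = 1$.
\<close>
lemma L_series_principal_unbounded:
  assumes m: "m > 0" and bd: "\<forall>\<^sub>F s in at_right 1. cmod (L_series (principal_dchar m) (of_real s)) \<le> B"
  shows False
proof -
  have part: "(\<Sum>k<N. 1 / real (1 + k * m)) \<le> B" for N
  proof -
    have "\<forall>\<^sub>F s in at_right (1::real). s > 1" by (simp add: eventually_at_right_less)
    with bd have "\<forall>\<^sub>F s in at_right 1. (\<Sum>k<N. real (1 + k * m) powr - s) \<le> B"
    proof eventually_elim
      case (elim s)
      let ?f = "\<lambda>n. principal_dchar m n * of_nat n powr (- of_real s)"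
      have f: "?f n = of_real (of_bool (coprime n m) * real n powr - s)" for n
        unfolding principal_dchar_def of_nat_powr_real by simp
      have sm: "summable (\<lambda>n. of_bool (coprime n m) * real n powr - s)"
        using summable_norm_cancel[OF summable_norm_L_series[OF principal_dchar_in_dchars m, of "of_real s"]] elim
        unfolding f summable_of_real_iff by simp
      have "(\<Sum>k<N. real (1 + k * m) powr - s) = (\<Sum>n\<in>(\<lambda>k. 1 + k * m) ` {..<N}. real n powr - s)"
        using m by (subst sum.reindex) (auto simp: inj_on_def)
      also have "\<dots> = (\<Sum>n\<in>(\<lambda>k. 1 + k * m) ` {..<N}. of_bool (coprime n m) * real n powr - s)"
      proof (intro sum.cong refl)
        fix n assume "n \<in> (\<lambda>k. 1 + k * m) ` {..<N}"
        then obtain k where k: "n = 1 + k * m" by auto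
        have "coprime (1 + k * m) m"
        proof (rule coprimeI)
          fix d assume "d dvd 1 + k * m" "d dvd m"
          then show "is_unit d" by (metis dvd_add_left_iff dvd_mult)
        qed
        then show "real n powr - s = of_bool (coprime n m) * real n powr - s" using k by simp
      qed
      also have "\<dots> \<le> (\<Sum>n. of_bool (coprime n m) * real n powr - s)"
        by (intro sum_le_suminf sm) auto
      also have "\<dots> = Re (L_series (principal_dchar m) (of_real s))"
        unfolding L_series_def f suminf_of_real[OF sm, symmetric] by simp
      also have "\<dots> \<le> B" using elim complex_Re_le_cmod order_trans by blast
      finally show ?case .
    qed
    moreover have nz: "real (1 + k * m) \<noteq> 0" for k
      unfolding of_nat_eq_0_iff by simp
    moreover have "((\<lambda>s. \<Sum>k<N. real (1 + k * m) powr - s) \<longlongrightarrow> (\<Sum>k<N. real (1 + k * m) powr - 1)) (at_right 1)"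
      by (intro tendsto_intros disjI1 nz)
    ultimately have "(\<Sum>k<N. real (1 + k * m) powr - 1) \<le> B"
      by (intro tendsto_upperbound) auto
    then show ?thesis by (simp add: powr_minus divide_inverse)
  qed
  have "summable (\<lambda>k. 1 / real (1 + k * m))"
    by (rule bounded_imp_summable[of _ B]) (use part[of "Suc _"] in \<open>auto simp: lessThan_Suc_atMost\<close>)
  then have "summable (\<lambda>k. 1 / real (1 + k * m) * real m)" by (rule summable_mult2)
  then have "summable (\<lambda>k. inverse (real (Suc k)))"
  proof (rule summable_comparison_test'[where N = 0])
    fix k
    have "real m \<ge> 1" using m by simp
    then have "1 + real k * real m \<le> (1 + real k) * real m" by (simp add: algebra_simps)
    then have "(1 + real k * real m) / (1 + real k) \<le> real m" by (simp add: field_simps)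
    then show "norm (inverse (real (Suc k))) \<le> 1 / real (1 + k * m) * real m"
      by (simp add: field_simps add_pos_nonneg)
  qed
  then have "summable (\<lambda>k. inverse (real k))" by (subst (asm) summable_Suc_iff)
  with not_summable_harmonic[where 'a = real] show False by simp
qed

text \<open>
  If the progression contained finitely many primes, the series $H$ of the principal character would be bounded near
  $1$ by orthogonality, and $L' = -HL$ would keep its $L$-series bounded.
\<close>
theorem dirichlet_squarefree:
  fixes a m :: nat
  assumes m: "squarefree m" "m > 0" and a: "coprime a m"
  shows "infinite {r. prime r \<and> [r = a] (mod m)}"
proof
  assume fin: "finite {r. prime r \<and> [r = a] (mod m)}"
  let ?p = "principal_dchar m"
  obtain B0 where B0: "\<And>s. s > 1 \<Longrightarrow> class_mangoldt m a s \<le> B0"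
    using class_mangoldt_bounded[OF fin] by blast
  define X where "X = dchars m - {?p}"
  have finX: "finite X" using finite_dchars[OF m(2)] by (simp add: X_def)
  obtain M where M: "\<And>\<xi>. \<xi> \<in> X \<Longrightarrow> \<forall>\<^sub>F s in at_right 1. cmod (mangoldt_series \<xi> (of_real s)) \<le> M \<xi>"
    using mangoldt_series_bounded[OF m] unfolding X_def by (metis DiffE singletonI)
  define B where "B = card (dchars m) * B0 + (\<Sum>\<xi>\<in>X. M \<xi>)"
  have "\<forall>\<^sub>F s in at_right (1::real). s > 1" by (simp add: eventually_at_right_less)
  moreover have "\<forall>\<^sub>F s in at_right 1. \<forall>\<xi>\<in>X. cmod (mangoldt_series \<xi> (of_real s)) \<le> M \<xi>"
    using finX M by (intro eventually_ball_finite) auto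
  ultimately have "\<forall>\<^sub>F s in at_right 1. cmod (mangoldt_series ?p (of_real s)) \<le> B"
  proof eventually_elim
    case (elim s)
    let ?z = "complex_of_real s"
    have "of_real (card (dchars m) * class_mangoldt m a s) =
        cnj (?p a) * mangoldt_series ?p ?z + (\<Sum>\<xi>\<in>X. cnj (\<xi> a) * mangoldt_series \<xi> ?z)"
      unfolding sum_mangoldt_series[OF m a elim(1), symmetric] X_def
      by (rule sum.remove[OF finite_dchars[OF m(2)] principal_dchar_in_dchars])
    moreover have "cnj (?p a) = 1" using a by (simp add: principal_dchar_def)
    ultimately have "mangoldt_series ?p ?z =
        of_real (card (dchars m) * class_mangoldt m a s) - (\<Sum>\<xi>\<in>X. cnj (\<xi> a) * mangoldt_series \<xi> ?z)"
      by (simp add: algebra_simps)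
    also have "cmod \<dots> \<le> cmod (of_real (card (dchars m) * class_mangoldt m a s)) +
        cmod (\<Sum>\<xi>\<in>X. cnj (\<xi> a) * mangoldt_series \<xi> ?z)"
      by (rule norm_triangle_ineq4)
    also have "\<dots> \<le> card (dchars m) * B0 + (\<Sum>\<xi>\<in>X. M \<xi>)"
    proof (intro add_mono sum_norm_le)
      have "cmod (of_real (card (dchars m) * class_mangoldt m a s)) = card (dchars m) * class_mangoldt m a s"
        using class_mangoldt_nonneg[OF elim(1), of m a] by (simp only: norm_of_real abs_of_nonneg mult_nonneg_nonneg of_nat_0_le_iff)
      also have "\<dots> \<le> card (dchars m) * B0" using B0[OF elim(1)] by (intro mult_left_mono) auto
      finally show "cmod (of_real (card (dchars m) * class_mangoldt m a s)) \<le> card (dchars m) * B0" .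
      fix \<xi> assume \<xi>: "\<xi> \<in> X"
      have "cmod (cnj (\<xi> a) * mangoldt_series \<xi> ?z) \<le> 1 * cmod (mangoldt_series \<xi> ?z)"
        unfolding norm_mult complex_mod_cnj
        using \<xi> m(2) by (intro mult_right_mono cmod_dchars_le_1) (auto simp: X_def)
      also have "\<dots> \<le> M \<xi>" using elim(2) \<xi> by simp
      finally show "cmod (cnj (\<xi> a) * mangoldt_series \<xi> ?z) \<le> M \<xi>" .
    qed
    finally show ?case by (simp add: B_def)
  qed
  then obtain t where t: "t > 1" "\<And>s. 1 < s \<Longrightarrow> s < t \<Longrightarrow> cmod (mangoldt_series ?p (of_real s)) \<le> B"
    unfolding eventually_at_right_field by blast
  define t' where "t' = (1 + t) / 2"
  have t': "1 < t'" "t' < t" using t(1) by (auto simp: t'_def)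
  have B: "B \<ge> 0" using t(2)[OF t'] norm_ge_zero order_trans by blast
  \<comment> \<open>The logarithmic derivative of \<open>G\<close> is \<open>B - H\<close>, which has nonnegative real part where \<open>H\<close> is bounded by \<open>B\<close>.\<close>
  define G where "G z = L_series ?p z * exp (of_real B * z)" for z
  have bound: "cmod (L_series ?p (of_real s)) \<le> cmod (G (of_real t'))" if s: "1 < s" "s \<le> t'" for s
  proof -
    have "cmod (G (of_real s)) \<le> cmod (G (of_real t'))"
    proof (rule cmod_exponential_growth(2)[where g = "\<lambda>x. of_real B - mangoldt_series ?p (of_real x)"])
      fix x assume x: "s \<le> x" "x \<le> t'"
      let ?x = "complex_of_real x"
      have "(L_series ?p has_field_derivative - log_series ?p ?x) (at ?x)"
        using x s by (intro L_series_derivative[OF principal_dchar_in_dchars m(2)]) simp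
      then have "(G has_field_derivative
          - log_series ?p ?x * exp (of_real B * ?x) + L_series ?p ?x * (of_real B * exp (of_real B * ?x))) (at ?x)"
        unfolding G_def[abs_def] by (auto intro!: derivative_eq_intros)
      moreover have "log_series ?p ?x = L_series ?p ?x * mangoldt_series ?p ?x"
        using x s by (intro L_series_mangoldt_series[OF principal_dchar_in_dchars m(2), symmetric]) simp
      ultimately show "(G has_field_derivative (of_real B - mangoldt_series ?p ?x) * G ?x) (at ?x)"
        by (simp add: G_def algebra_simps)
      have "Re (mangoldt_series ?p ?x) \<le> B"
        using t(2)[of x] x s t' complex_Re_le_cmod order_trans by fastforce
      then show "0 \<le> Re (of_real B - mangoldt_series ?p ?x)" by simp
    qed (use s in auto)
    moreover have "cmod (L_series ?p (of_real s)) * 1 \<le> cmod (G (of_real s))"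
      unfolding G_def norm_mult using B s by (intro mult_left_mono) (auto simp: norm_exp_eq_Re)
    ultimately show ?thesis by simp
  qed
  have "\<forall>\<^sub>F s in at_right 1. s \<in> {1<..<t'}" using t'(1) by (rule eventually_at_right_real)
  then have "\<forall>\<^sub>F s in at_right 1. cmod (L_series ?p (of_real s)) \<le> cmod (G (of_real t'))"
  proof eventually_elim
    case (elim s)
    then show ?case by (intro bound) auto
  qed
  then show False by (rule L_series_principal_unbounded[OF m(2)])
qed

section \<open>The maximal ternary height\<close>

theorem theorem5:
  fixes p :: nat
  assumes "prime p" and "p \<ge> 5" and "prime (2 * p - 1)"
  shows "finite (ternary_heights p (2 * p - 1)) \<and> max_ternary_height p (2 * p - 1) = 3"
proof -
  define q where "q = 2 * p - 1"
  have q: "prime q" using assms(3) by (simp add: q_def)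
  have "p \<noteq> 5"
  proof
    assume "p = 5"
    then have "q = 9" by (simp add: q_def)
    then have "3 dvd q" by simp
    then have "(3::nat) = 1 \<or> 3 = q" using q unfolding prime_nat_iff by blast
    then show False using \<open>q = 9\<close> by simp
  qed
  moreover have "p \<noteq> 6"
  proof
    assume "p = 6"
    then have "2 dvd p" by simp
    then have "(2::nat) = 1 \<or> 2 = p" using assms(1) unfolding prime_nat_iff by blast
    then show False using \<open>p = 6\<close> by simp
  qed
  ultimately have p7: "p \<ge> 7" using assms(2) by simp
  have "q > p" using p7 by (simp add: q_def)
  have sub: "ternary_heights p q \<subseteq> {0, 1, 2, 3}"
  proof
    fix h assume "h \<in> ternary_heights p q"
    then obtain r where r: "prime r" "r > q" "h = cyclotomic_height (p * q * r)"
      by (auto simp: ternary_heights_def)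
    have "p \<noteq> r" "q \<noteq> r" using r(2) \<open>q > p\<close> by auto
    then show "h \<in> {0, 1, 2, 3}"
      unfolding r(3) by (intro cyclotomic_height_ternary(1)[OF assms(1) q r(1) _ _ q_def])
  qed
  then have fin: "finite (ternary_heights p q)" by (rule finite_subset) simp
  have cop: "coprime p q" using assms(1) q \<open>q > p\<close> by (intro primes_coprime) auto
  \<comment> \<open>The residue classes for which \<open>coeff_eq_3\<close> applies; \<open>q - 4\<close> stands for \<open>-4\<close>.\<close>
  obtain a where a: "[a = 2] (mod p)" "[a = q - 4] (mod q)"
    using binary_chinese_remainder_nat[OF cop] by blast
  have "coprime a p"
  proof -
    have "coprime 2 p" using assms(1) p7 by (intro primes_coprime) auto
    then show ?thesis using a(1) by (simp add: coprime_cong_cong_left)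
  qed
  moreover have "coprime a q"
  proof -
    have "coprime 2 q" using q p7 \<open>q > p\<close> by (intro primes_coprime) auto
    then have "coprime (2 ^ 2) q" unfolding coprime_power_left_iff by simp
    then have "coprime 4 q" by simp
    have "coprime (q - 4) q"
    proof (rule coprimeI)
      fix d assume d: "d dvd q - 4" "d dvd q"
      have "d dvd q - (q - 4)" by (rule dvd_diff_nat[OF d(2,1)])
      moreover have "q - (q - 4) = 4" using p7 \<open>q > p\<close> by simp
      ultimately have "d dvd 4" by simp
      then show "is_unit d" using \<open>coprime 4 q\<close> d(2) coprime_common_divisor by blast
    qed
    then show ?thesis using a(2) by (simp add: coprime_cong_cong_left)
  qed
  ultimately have "coprime a (p * q)" by simp
  moreover have "squarefree (p * q)"
    using assms(1) q cop by (intro squarefree_mult_coprime squarefree_prime)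
  moreover have "p * q > 0" using assms(1) q by (simp add: prime_gt_0_nat)
  ultimately have "infinite {r. prime r \<and> [r = a] (mod (p * q))}"
    by (intro dirichlet_squarefree)
  then obtain r where r: "r > p + q + p * q" "prime r" "[r = a] (mod (p * q))"
    unfolding infinite_nat_iff_unbounded by auto
  have "[r = a] (mod p)" "[r = a] (mod q)"
    using r(3) by (rule cong_dvd_modulus_nat; simp)+
  then have "[r = 2] (mod p)" "[r = q - 4] (mod q)" using a by (blast intro: cong_trans)+
  then have rp: "[int r = 2] (mod int p)" and "[int r = int (q - 4)] (mod int q)"
    by (metis cong_int_iff of_nat_numeral)+
  moreover have "[int (q - 4) = -4] (mod int q)"
    using p7 \<open>q > p\<close> by (simp add: cong_iff_dvd_diff of_nat_diff)
  ultimately have rq: "[int r = -4] (mod int q)" by (blast intro: cong_trans)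
  obtain n where n: "coeff (cyclotomic_poly (p * q * r)) n = 3"
    using coeff_eq_3[OF assms(1) q r(2) p7 q_def rp rq r(1)] by blast
  have rne: "p \<noteq> r" "q \<noteq> r" "r > q" using r(1) by auto
  have "cyclotomic_height (p * q * r) \<ge> 3"
    using cyclotomic_height_ternary(2)[OF assms(1) q r(2) rne(1,2) q_def, of n] n by simp
  moreover have "cyclotomic_height (p * q * r) \<in> {0, 1, 2, 3}"
    by (rule cyclotomic_height_ternary(1)[OF assms(1) q r(2) rne(1,2) q_def])
  ultimately have "cyclotomic_height (p * q * r) = 3" by auto
  then have "3 \<in> ternary_heights p q"
    unfolding ternary_heights_def using r(2) rne(3) by (intro CollectI exI[of _ r]) simp
  then have "Max (ternary_heights p q) = 3"
    using sub by (intro Max_eqI[OF fin]) auto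
  with fin show ?thesis by (simp add: max_ternary_height_def q_def)
qed

end
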